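(* Let a group $G$ act properly by simplicial automorphisms on a finite dimensional weakly systolic complex $\mathbf X$. Then $\mathbf X$ is a finite dimensional model for $\underline{E}G$. If, moreover, the action of $G$ on $\mathbf X$ is cocompact, then $\mathbf X$ is a finite model for $\underline{E}G$.
   Context: All simplicial complexes are flag (every set of vertices, each pair of which lies in a common simplex, is contained in a simplex) with connected $1$-skeleton. Distances, balls $B_r(v)$ and spheres $S_r(v)$ in $\mathbf X$ are those of its $1$-skeleton with the path metric. A flag complex $\mathbf X$ is weakly systolic if for every vertex $v$, every integer $i\ge 0$ and every simplex $\sigma$ with all vertices in $S_{i+1}(v)$, the set of vertices of $B_i(v)$ adjacent to all vertices of $\sigma$ spans a nonempty simplex. A simplicial action is proper if stabilizers of simplices are finite; it is cocompact if the orbit space $G\backslash\mathbf X$ is compact. If $G$ acts properly on a space $\mathbf X$ such that the fixed point set of any finite subgroup of $G$ is contractible (and therefore non-empty), then $\mathbf X$ is called a model for $\underline{E}G$ (the classifying space for finite subgroups). If additionally the action is cocompact, $\mathbf X$ is called a finite model for $\underline{E}G$. Fixed point sets are taken in the geometric realization of $\mathbf X$. *)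

theory Defs
  imports "HOL-Algebra.Group_Action" "HOL-Analysis.Analysis"
begin

section \<open>Flag complexes\<close>

text \<open>A complex is given by the set of its simplices, and a simplex by its finite nonempty
  vertex set; the empty simplex is not included.\<close>

definition simplicial_complex :: "'v set set \<Rightarrow> bool" where
  "simplicial_complex K \<longleftrightarrow>
     (\<forall>\<sigma>\<in>K. finite \<sigma> \<and> \<sigma> \<noteq> {}) \<and> (\<forall>\<sigma>\<in>K. \<forall>\<tau>. \<tau> \<subseteq> \<sigma> \<and> \<tau> \<noteq> {} \<longrightarrow> \<tau> \<in> K)"

definition vertices :: "'v set set \<Rightarrow> 'v set" where
  "vertices K = \<Union>K"

definition finite_dimensional :: "'v set set \<Rightarrow> bool" where
  "finite_dimensional K \<longleftrightarrow> (\<exists>n. \<forall>\<sigma>\<in>K. card \<sigma> \<le> Suc n)"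

definition flag :: "'v set set \<Rightarrow> bool" where
  "flag K \<longleftrightarrow>
     (\<forall>S \<subseteq> vertices K. (\<forall>u\<in>S. \<forall>v\<in>S. \<exists>\<sigma>\<in>K. u \<in> \<sigma> \<and> v \<in> \<sigma>) \<longrightarrow> (\<exists>\<sigma>\<in>K. S \<subseteq> \<sigma>))"

definition edge_rel :: "'v set set \<Rightarrow> ('v \<times> 'v) set" where
  "edge_rel K = {(u, v). u \<noteq> v \<and> {u, v} \<in> K}"

text \<open>A connected graph is nonempty.\<close>

definition connected_1_skeleton :: "'v set set \<Rightarrow> bool" where
  "connected_1_skeleton K \<longleftrightarrow>
     vertices K \<noteq> {} \<and> (\<forall>u\<in>vertices K. \<forall>v\<in>vertices K. (u, v) \<in> (edge_rel K)\<^sup>*)"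

text \<open>The path metric; meaningful for vertices joined by an edge path, which is always the case
  when the 1-skeleton is connected.\<close>

definition graph_dist :: "'v set set \<Rightarrow> 'v \<Rightarrow> 'v \<Rightarrow> nat" where
  "graph_dist K u v = (LEAST n. (u, v) \<in> edge_rel K ^^ n)"

definition graph_ball :: "'v set set \<Rightarrow> 'v \<Rightarrow> nat \<Rightarrow> 'v set" where
  "graph_ball K v r = {w \<in> vertices K. graph_dist K v w \<le> r}"

definition graph_sphere :: "'v set set \<Rightarrow> 'v \<Rightarrow> nat \<Rightarrow> 'v set" where
  "graph_sphere K v r = {w \<in> vertices K. graph_dist K v w = r}"

text \<open>Members of \<open>K\<close> are nonempty, so the last conjunct asks for a nonempty simplex.\<close>

definition weakly_systolic :: "'v set set \<Rightarrow> bool" where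
  "weakly_systolic K \<longleftrightarrow>
     simplicial_complex K \<and> flag K \<and> connected_1_skeleton K \<and>
     (\<forall>v\<in>vertices K. \<forall>i. \<forall>\<sigma>\<in>K. \<sigma> \<subseteq> graph_sphere K v (Suc i) \<longrightarrow>
        {w \<in> graph_ball K v i. \<forall>u\<in>\<sigma>. (w, u) \<in> edge_rel K} \<in> K)"

section \<open>Geometric realization\<close>

text \<open>Points are given by their barycentric coordinates.\<close>

definition realized_simplex :: "'v set \<Rightarrow> ('v \<Rightarrow> real) set" where
  "realized_simplex \<sigma> =
     {x. (\<forall>v. 0 \<le> x v) \<and> (\<forall>v. v \<notin> \<sigma> \<longrightarrow> x v = 0) \<and> (\<Sum>v\<in>\<sigma>. x v) = 1}"

text \<open>The realization carries the weak topology with respect to its closed simplices, which need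
  not be the one induced from the function space when \<open>K\<close> is not locally finite. On a single
  simplex, the product topology of the function space induces the Euclidean topology.\<close>

definition realization :: "'v set set \<Rightarrow> ('v \<Rightarrow> real) topology" where
  "realization K = topology (\<lambda>U. U \<subseteq> (\<Union>\<sigma>\<in>K. realized_simplex \<sigma>) \<and>
     (\<forall>\<sigma>\<in>K. openin (top_of_set (realized_simplex \<sigma>)) (U \<inter> realized_simplex \<sigma>)))"

lemma openin_realization:
  "openin (realization K) U \<longleftrightarrow> U \<subseteq> (\<Union>\<sigma>\<in>K. realized_simplex \<sigma>) \<and>
     (\<forall>\<sigma>\<in>K. openin (top_of_set (realized_simplex \<sigma>)) (U \<inter> realized_simplex \<sigma>))"
proof -
  let ?P = "\<lambda>U. U \<subseteq> (\<Union>\<sigma>\<in>K. realized_simplex \<sigma>) \<and>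
     (\<forall>\<sigma>\<in>K. openin (top_of_set (realized_simplex \<sigma>)) (U \<inter> realized_simplex \<sigma>))"
  have "istopology ?P"
    unfolding istopology_def
  proof (intro conjI allI impI)
    fix S T assume S: "?P S" and T: "?P T"
    have "openin (top_of_set (realized_simplex \<sigma>)) (S \<inter> T \<inter> realized_simplex \<sigma>)"
      if "\<sigma> \<in> K" for \<sigma>
    proof -
      have "S \<inter> T \<inter> realized_simplex \<sigma> =
          (S \<inter> realized_simplex \<sigma>) \<inter> (T \<inter> realized_simplex \<sigma>)" by blast
      moreover have "openin (top_of_set (realized_simplex \<sigma>))
          ((S \<inter> realized_simplex \<sigma>) \<inter> (T \<inter> realized_simplex \<sigma>))"
        by (rule openin_Int) (use S T that in simp_all)
      ultimately show ?thesis by (simp only:)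
    qed
    then show "\<forall>\<sigma>\<in>K. openin (top_of_set (realized_simplex \<sigma>)) (S \<inter> T \<inter> realized_simplex \<sigma>)"
      by simp
    show "S \<inter> T \<subseteq> (\<Union>\<sigma>\<in>K. realized_simplex \<sigma>)"
      using S by (simp add: le_infI1)
  next
    fix \<U> assume U: "\<forall>U\<in>\<U>. ?P U"
    then show "\<Union>\<U> \<subseteq> (\<Union>\<sigma>\<in>K. realized_simplex \<sigma>)" by (simp add: Union_least)
    show "\<forall>\<sigma>\<in>K. openin (top_of_set (realized_simplex \<sigma>)) (\<Union>\<U> \<inter> realized_simplex \<sigma>)"
    proof
      fix \<sigma> assume "\<sigma> \<in> K"
      have "openin (top_of_set (realized_simplex \<sigma>)) (\<Union>U\<in>\<U>. U \<inter> realized_simplex \<sigma>)"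
        by (rule openin_Union) (use U \<open>\<sigma> \<in> K\<close> in auto)
      then show "openin (top_of_set (realized_simplex \<sigma>)) (\<Union>\<U> \<inter> realized_simplex \<sigma>)"
        by (simp only: Int_Union2)
    qed
  qed
  then show ?thesis unfolding realization_def by (simp add: topology_inverse')
qed

lemma topspace_realization: "topspace (realization K) = (\<Union>\<sigma>\<in>K. realized_simplex \<sigma>)"
proof
  show "topspace (realization K) \<subseteq> (\<Union>\<sigma>\<in>K. realized_simplex \<sigma>)"
    using openin_topspace[of "realization K"] unfolding openin_realization by simp
  have "openin (realization K) (\<Union>\<sigma>\<in>K. realized_simplex \<sigma>)"
    unfolding openin_realization by (simp add: Int_absorb1 UN_upper)
  then show "(\<Union>\<sigma>\<in>K. realized_simplex \<sigma>) \<subseteq> topspace (realization K)"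
    by (rule openin_subset)
qed

section \<open>Group actions\<close>

definition simplicial_action ::
  "('g, 'b) monoid_scheme \<Rightarrow> 'v set set \<Rightarrow> ('g \<Rightarrow> 'v \<Rightarrow> 'v) \<Rightarrow> bool" where
  "simplicial_action G K \<phi> \<longleftrightarrow>
     group_action G (vertices K) \<phi> \<and> (\<forall>g\<in>carrier G. \<forall>\<sigma>\<in>K. \<phi> g ` \<sigma> \<in> K)"

text \<open>Setwise stabilizers of simplices.\<close>

definition proper_action ::
  "('g, 'b) monoid_scheme \<Rightarrow> 'v set set \<Rightarrow> ('g \<Rightarrow> 'v \<Rightarrow> 'v) \<Rightarrow> bool" where
  "proper_action G K \<phi> \<longleftrightarrow> (\<forall>\<sigma>\<in>K. finite (stabilizer G (\<lambda>g. image (\<phi> g)) \<sigma>))"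

text \<open>The affine extension of the action: the coordinate of \<open>g x\<close> at \<open>g v\<close> is the coordinate of
  \<open>x\<close> at \<open>v\<close>.\<close>

definition realization_action ::
  "('g, 'b) monoid_scheme \<Rightarrow> 'v set set \<Rightarrow> ('g \<Rightarrow> 'v \<Rightarrow> 'v) \<Rightarrow> 'g \<Rightarrow> ('v \<Rightarrow> real) \<Rightarrow> 'v \<Rightarrow> real" where
  "realization_action G K \<phi> g x = (\<lambda>w. if w \<in> vertices K then x (\<phi> (inv\<^bsub>G\<^esub> g) w) else 0)"

definition fixed_points ::
  "('g, 'b) monoid_scheme \<Rightarrow> 'v set set \<Rightarrow> ('g \<Rightarrow> 'v \<Rightarrow> 'v) \<Rightarrow> 'g set \<Rightarrow> ('v \<Rightarrow> real) set" where
  "fixed_points G K \<phi> H =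
     {x \<in> topspace (realization K). \<forall>h\<in>H. realization_action G K \<phi> h x = x}"

text \<open>The quotient topology on the set of orbits in the realization.\<close>

definition orbit_space ::
  "('g, 'b) monoid_scheme \<Rightarrow> 'v set set \<Rightarrow> ('g \<Rightarrow> 'v \<Rightarrow> 'v) \<Rightarrow> ('v \<Rightarrow> real) set topology" where
  "orbit_space G K \<phi> = topology (\<lambda>U.
     U \<subseteq> orbits G (topspace (realization K)) (realization_action G K \<phi>) \<and>
     openin (realization K)
       {x \<in> topspace (realization K). orbit G (realization_action G K \<phi>) x \<in> U})"

lemma openin_orbit_space:
  "openin (orbit_space G K \<phi>) U \<longleftrightarrow>
     U \<subseteq> orbits G (topspace (realization K)) (realization_action G K \<phi>) \<and>
     openin (realization K)
       {x \<in> topspace (realization K). orbit G (realization_action G K \<phi>) x \<in> U}"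
proof -
  let ?q = "orbit G (realization_action G K \<phi>)"
  let ?P = "\<lambda>U. U \<subseteq> orbits G (topspace (realization K)) (realization_action G K \<phi>) \<and>
     openin (realization K) {x \<in> topspace (realization K). ?q x \<in> U}"
  have "istopology ?P"
    unfolding istopology_def
  proof (intro conjI allI impI)
    fix S T assume S: "?P S" and T: "?P T"
    have "{x \<in> topspace (realization K). ?q x \<in> S \<inter> T} =
        {x \<in> topspace (realization K). ?q x \<in> S} \<inter> {x \<in> topspace (realization K). ?q x \<in> T}"
      by blast
    moreover have "openin (realization K)
        ({x \<in> topspace (realization K). ?q x \<in> S} \<inter> {x \<in> topspace (realization K). ?q x \<in> T})"
      by (rule openin_Int) (use S T in simp_all)
    ultimately show "openin (realization K) {x \<in> topspace (realization K). ?q x \<in> S \<inter> T}"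
      by (simp only:)
    show "S \<inter> T \<subseteq> orbits G (topspace (realization K)) (realization_action G K \<phi>)"
      using S by blast
  next
    fix \<U> assume U: "\<forall>U\<in>\<U>. ?P U"
    have "{x \<in> topspace (realization K). ?q x \<in> \<Union>\<U>} =
        (\<Union>U\<in>\<U>. {x \<in> topspace (realization K). ?q x \<in> U})"
      by blast
    moreover have "openin (realization K) (\<Union>U\<in>\<U>. {x \<in> topspace (realization K). ?q x \<in> U})"
      by (rule openin_Union) (use U in auto)
    ultimately show "openin (realization K) {x \<in> topspace (realization K). ?q x \<in> \<Union>\<U>}"
      by simp
    show "\<Union>\<U> \<subseteq> orbits G (topspace (realization K)) (realization_action G K \<phi>)"
      using U by blast
  qed
  then show ?thesis unfolding orbit_space_def by (simp add: topology_inverse')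
qed

definition cocompact_action ::
  "('g, 'b) monoid_scheme \<Rightarrow> 'v set set \<Rightarrow> ('g \<Rightarrow> 'v \<Rightarrow> 'v) \<Rightarrow> bool" where
  "cocompact_action G K \<phi> \<longleftrightarrow> compact_space (orbit_space G K \<phi>)"

section \<open>Classifying spaces for finite subgroups\<close>

text \<open>Nonemptiness is stated separately because \<^const>\<open>contractible_space\<close> holds of the empty
  space.\<close>

definition model_EG ::
  "('g, 'b) monoid_scheme \<Rightarrow> 'v set set \<Rightarrow> ('g \<Rightarrow> 'v \<Rightarrow> 'v) \<Rightarrow> bool" where
  "model_EG G K \<phi> \<longleftrightarrow>
     simplicial_complex K \<and> simplicial_action G K \<phi> \<and> proper_action G K \<phi> \<and>
     (\<forall>H. subgroup H G \<and> finite H \<longrightarrow>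
        fixed_points G K \<phi> H \<noteq> {} \<and>
        contractible_space (subtopology (realization K) (fixed_points G K \<phi> H)))"

definition finite_model_EG ::
  "('g, 'b) monoid_scheme \<Rightarrow> 'v set set \<Rightarrow> ('g \<Rightarrow> 'v \<Rightarrow> 'v) \<Rightarrow> bool" where
  "finite_model_EG G K \<phi> \<longleftrightarrow> model_EG G K \<phi> \<and> cocompact_action G K \<phi>"

end

(*
Write B_n for the set of vertices at distance at most n from every vertex of a simplex s_0. Balls
of a weakly systolic complex are convex, and the descent condition, postulated only for balls
around vertices, holds for the sets B_n with n >= 1 as well: a simplex of B_(n+1) disjoint from B_n
has a nonempty simplex as its projection to B_n. Moving the simplices of each layer to their
projections is canonical, hence commutes with all automorphisms that preserve s_0, so the
realization contracts to the barycenter of s_0 through fixed points of any such group.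

It remains to find an invariant simplex for a finite group. The convex hull of a finite set can be
infinite when the complex is not locally finite, so a minimal counterexample is treated as follows.
Let Q be a finite invariant set of minimal diameter D >= 2, contained in a convex invariant set X of
diameter at most D, and let s be a maximal simplex of X. By maximality no vertex of X is at distance D
from all of s. By convexity of balls, the parts of s within distance D - 1 of two vertices at
distance at most D - 1 are comparable. Hence the finite graph on the orbit of s in which two
vertices are joined when their distance is at most D - 1 dismantles onto s, and a dismantlable
finite graph has an invariant clique: an invariant set of smaller diameter.
*)

theory Submission
  imports Defs
begin

section \<open>Metric geometry of weakly systolic complexes\<close>

text \<open>The base has to be a simplex because a finite group may fix no vertex. Single balls are
  then replaced by intersections of balls around its vertices; at radius 0 such an intersection is
  empty once there are two vertices, so the layers begin at radius 1. A larger simplex has a smaller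
  projection, so sending simplices to projections is not a simplicial map. A point is instead cut
  into slices according to its barycentric weights, and each slice, a superlevel simplex, has its
  own projection. There may be infinitely many layers and no outermost one to start from. The
  contraction therefore uses an infinite amount of time, compressed into the unit interval, and each
  point rests until its own layer is due. Without local finiteness, coordinatewise continuity is too
  weak for the weak topology; it is accompanied throughout by a finite set of vertices that contains
  all supports over a given simplex. The search for an invariant simplex is driven by the diameter
  alone: the set that replaces \<open>Q\<close> may well have more vertices.\<close>

locale flag_complex =
  fixes K :: "'v set set"
  assumes complex: "simplicial_complex K"
    and flag: "flag K"
    and connected: "connected_1_skeleton K"
begin

abbreviation V :: "'v set" where "V \<equiv> vertices K"
abbreviation adj :: "'v \<Rightarrow> 'v \<Rightarrow> bool" where "adj u w \<equiv> (u, w) \<in> edge_rel K"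
abbreviation d :: "'v \<Rightarrow> 'v \<Rightarrow> nat" where "d \<equiv> graph_dist K"

lemma simplex_finite: "\<sigma> \<in> K \<Longrightarrow> finite \<sigma>"
  using complex unfolding simplicial_complex_def by blast

lemma simplex_nonempty: "\<sigma> \<in> K \<Longrightarrow> \<sigma> \<noteq> {}"
  using complex unfolding simplicial_complex_def by blast

lemma simplex_face: "\<lbrakk>\<sigma> \<in> K; \<tau> \<subseteq> \<sigma>; \<tau> \<noteq> {}\<rbrakk> \<Longrightarrow> \<tau> \<in> K"
  using complex unfolding simplicial_complex_def by blast

lemma simplex_subset: "\<sigma> \<in> K \<Longrightarrow> \<sigma> \<subseteq> V"
  unfolding vertices_def by auto

lemma vertex_simplex: "v \<in> V \<Longrightarrow> {v} \<in> K"
  unfolding vertices_def using simplex_face by blast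

lemma adj_sym: "adj u w \<Longrightarrow> adj w u"
  unfolding edge_rel_def by (auto simp: insert_commute)

lemma adj_neq: "adj u w \<Longrightarrow> u \<noteq> w"
  unfolding edge_rel_def by auto

lemma adj_vertices: "adj u w \<Longrightarrow> u \<in> V" "adj u w \<Longrightarrow> w \<in> V"
  unfolding edge_rel_def vertices_def by auto

lemma simplex_adj: "\<lbrakk>\<sigma> \<in> K; u \<in> \<sigma>; w \<in> \<sigma>; u \<noteq> w\<rbrakk> \<Longrightarrow> adj u w"
  unfolding edge_rel_def using simplex_face[of \<sigma> "{u, w}"] by auto

text \<open>Since \<open>flag\<close> also speaks of infinite sets, \<open>S\<close> need not be
  known to be finite; its finiteness follows from lying in a simplex. This is how projection sets
  turn out to be finite.\<close>

lemma clique_simplex: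
  assumes "S \<subseteq> V" "S \<noteq> {}" "\<And>u w. \<lbrakk>u \<in> S; w \<in> S; u \<noteq> w\<rbrakk> \<Longrightarrow> adj u w"
  shows "S \<in> K"
proof -
  have "\<exists>\<sigma>\<in>K. u \<in> \<sigma> \<and> w \<in> \<sigma>" if "u \<in> S" "w \<in> S" for u w
  proof (cases "u = w")
    case True
    then show ?thesis using that assms(1) vertex_simplex by blast
  next
    case False
    then have "{u, w} \<in> K" using assms(3) that unfolding edge_rel_def by auto
    then show ?thesis by blast
  qed
  then have "\<exists>\<sigma>\<in>K. S \<subseteq> \<sigma>" using flag[unfolded flag_def, rule_format, OF assms(1)] by simp
  then show ?thesis using simplex_face assms(2) by blast
qed

section \<open>The path metric of the 1-skeleton\<close>

lemma walk_exists: "\<lbrakk>u \<in> V; w \<in> V\<rbrakk> \<Longrightarrow> \<exists>n. (u, w) \<in> edge_rel K ^^ n"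
  using connected unfolding connected_1_skeleton_def by (metis rtrancl_imp_relpow)

lemma walk_d: "\<lbrakk>u \<in> V; w \<in> V\<rbrakk> \<Longrightarrow> (u, w) \<in> edge_rel K ^^ d u w"
  unfolding graph_dist_def by (rule LeastI_ex) (rule walk_exists)

lemma d_le_walk: "(u, w) \<in> edge_rel K ^^ n \<Longrightarrow> d u w \<le> n"
  unfolding graph_dist_def by (rule Least_le)

lemma walk_sym: "(u, w) \<in> edge_rel K ^^ n \<Longrightarrow> (w, u) \<in> edge_rel K ^^ n"
proof (induction n arbitrary: w)
  case (Suc n)
  then obtain x where "(u, x) \<in> edge_rel K ^^ n" "(x, w) \<in> edge_rel K" by auto
  then show ?case using Suc.IH adj_sym by (metis relpow_Suc_I2)
qed auto

lemma d_sym: "d u w = d w u"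
  unfolding graph_dist_def using walk_sym by metis

lemma d_triangle:
  assumes "u \<in> V" "w \<in> V" "x \<in> V" shows "d u x \<le> d u w + d w x"
proof -
  have "(u, x) \<in> edge_rel K ^^ (d u w + d w x)"
    using walk_d[OF assms(1,2)] walk_d[OF assms(2,3)] by (auto simp: relpow_add)
  then show ?thesis by (rule d_le_walk)
qed

lemma d_refl [simp]: "d u u = 0"
  using d_le_walk[of u u 0] by simp

lemma d_eq_0: "\<lbrakk>u \<in> V; w \<in> V\<rbrakk> \<Longrightarrow> d u w = 0 \<longleftrightarrow> u = w"
  using walk_d[of u w] by auto

lemma d_adj: "adj u w \<Longrightarrow> d u w = 1"
  using d_le_walk[of u w 1] d_eq_0[of u w] adj_neq[of u w] adj_vertices[of u w] by auto

lemma d_eq_1: "\<lbrakk>u \<in> V; w \<in> V\<rbrakk> \<Longrightarrow> d u w = 1 \<longleftrightarrow> adj u w"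
  using walk_d[of u w] d_adj by auto

lemma d_le_1: "\<lbrakk>u \<in> V; w \<in> V\<rbrakk> \<Longrightarrow> d u w \<le> 1 \<longleftrightarrow> u = w \<or> adj u w"
  using d_eq_1[of u w] d_eq_0[of u w] by linarith

lemma d_adj_le: "\<lbrakk>adj u w; x \<in> V\<rbrakk> \<Longrightarrow> d x w \<le> d x u + 1"
  using d_triangle[of x u w] d_adj[of u w] adj_vertices[of u w] by auto

lemma d_first_step:
  assumes "u \<in> V" "w \<in> V" "u \<noteq> w"
  obtains y where "adj u y" "d u w = d y w + 1"
proof -
  obtain n where n: "d u w = Suc n"
    using d_eq_0[OF assms(1,2)] assms(3) by (cases "d u w") auto
  then have "(u, w) \<in> edge_rel K ^^ Suc n" using walk_d[OF assms(1,2)] by simp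
  then obtain y where y: "adj u y" "(y, w) \<in> edge_rel K ^^ n"
    by (metis relpow_Suc_D2)
  have "d u w \<le> d y w + 1"
    using d_triangle[of u y w] d_adj[OF y(1)] adj_vertices[OF y(1)] assms by auto
  with d_le_walk[OF y(2)] n have "d u w = d y w + 1" by simp
  with y(1) show ?thesis by (rule that)
qed

end

locale weakly_systolic_complex = flag_complex K for K :: "'v set set" +
  assumes descent: "weakly_systolic K"
begin

lemma projection_simplex:
  assumes "v \<in> V" "\<sigma> \<in> K" "\<And>u. u \<in> \<sigma> \<Longrightarrow> d v u = Suc i"
  shows "{w \<in> V. d v w \<le> i \<and> (\<forall>u\<in>\<sigma>. adj w u)} \<in> K"
proof -
  have "\<sigma> \<subseteq> graph_sphere K v (Suc i)"
    unfolding graph_sphere_def using assms simplex_subset by auto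
  then have "{w \<in> graph_ball K v i. \<forall>u\<in>\<sigma>. adj w u} \<in> K"
    using descent[unfolded weakly_systolic_def] assms(1,2) by simp
  then show ?thesis unfolding graph_ball_def by (simp add: conj_assoc)
qed

lemma projection_exists:
  assumes "v \<in> V" "\<sigma> \<in> K" "\<And>u. u \<in> \<sigma> \<Longrightarrow> d v u = Suc i"
  obtains w where "w \<in> V" "d v w \<le> i" "\<And>u. u \<in> \<sigma> \<Longrightarrow> adj w u"
  using simplex_nonempty[OF projection_simplex[OF assms]] by blast

text \<open>The descent condition for the one-vertex simplex \<open>{t}\<close>: \<open>x\<close>
  and \<open>y\<close> both belong to its projection, which is a simplex.\<close>

lemma projection_clique:
  assumes "v \<in> V" "d v t = Suc i" "adj x t" "adj y t" "d v x \<le> i" "d v y \<le> i" "x \<noteq> y"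
  shows "adj x y"
proof -
  have "{t} \<in> K" using assms adj_vertices vertex_simplex by blast
  from projection_simplex[OF assms(1) this] assms(2)
  have "{w \<in> V. d v w \<le> i \<and> (\<forall>u\<in>{t}. adj w u)} \<in> K" by auto
  from simplex_adj[OF this] show ?thesis
    using assms adj_vertices(1)[OF assms(3)] adj_vertices(1)[OF assms(4)] by simp
qed

text \<open>If \<open>a\<close> and \<open>c\<close> are not adjacent, they are at distance 2, and
  \<open>b\<close>, \<open>e\<close> lie in the projection of \<open>{c}\<close> seen from
  \<open>a\<close>.\<close>

lemma no_induced_C4:
  assumes "adj a b" "adj b c" "adj c e" "adj e a" "a \<noteq> c" "b \<noteq> e"
  shows "adj a c \<or> adj b e"
proof (rule ccontr)
  assume *: "\<not> ?thesis"
  have V: "a \<in> V" "b \<in> V" "c \<in> V" "e \<in> V" using assms adj_vertices by blast+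
  have "d a c \<le> 2" using d_adj_le[OF assms(2) V(1)] d_adj[OF assms(1)] by simp
  moreover have "\<not> d a c \<le> 1" using d_le_1 V * assms(5) by blast
  ultimately have "d a c = Suc 1" by simp
  moreover have "d a b \<le> 1" "d a e \<le> 1" using d_adj[OF assms(1)] d_adj[OF assms(4)] d_sym[of a e] by auto
  ultimately have "adj b e"
    by (intro projection_clique[of a c 1 b e]) (use V assms adj_sym in simp_all)
  with * show False by simp
qed

lemma edge_simplex: "adj u w \<Longrightarrow> {u, w} \<in> K"
  unfolding edge_rel_def by auto

text \<open>Induction on the length of the geodesic, for all radii at once, because its inner part
  is handled with radius \<open>Suc R\<close>. In a shortest violation every proper subgeodesic is
  already controlled, so both neighbors of the ends leave the ball of radius \<open>R\<close>
  immediately, and the ends lie on its boundary.\<close>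

lemma ball_convex:
  assumes "z \<in> V" "a \<in> V" "b \<in> V" "x \<in> V"
    and "d z a \<le> R" "d z b \<le> R" "d a x + d x b = d a b"
  shows "d z x \<le> R"
  using assms(2-)
proof (induction "d a b" arbitrary: a b x R rule: less_induct)
  case less
  note V = \<open>z \<in> V\<close> less.prems(1-3) and a = less.prems(4) and b = less.prems(5) and ab = less.prems(6)
  show ?case
  proof (rule ccontr)
    assume bad: "\<not> d z x \<le> R"
    then have "x \<noteq> a" "x \<noteq> b" using a b by auto
    obtain x1 where x1: "adj a x1" "d a x = d x1 x + 1"
      using d_first_step[of a x] V \<open>x \<noteq> a\<close> by blast
    obtain x' where x': "adj b x'" "d b x = d x' x + 1"
      using d_first_step[of b x] V \<open>x \<noteq> b\<close> by blast
    have V': "x1 \<in> V" "x' \<in> V" using x1 x' adj_vertices by blast+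
    have xb: "d x b = d x x' + 1" using x'(2) by (simp only: d_sym[of x b] d_sym[of x x'])
    have dab: "d a b = d x1 x + d x x' + 2" using ab x1(2) xb by linarith
    have x1x': "d x1 x' \<le> d x1 x + d x x'" using d_triangle V V' by blast
    have ax1: "d a x1 = 1" "d b x' = 1" using d_adj[OF x1(1)] d_adj[OF x'(1)] by auto
    have x'b: "d x' b = 1" using ax1(2) by (simp only: d_sym[of x' b])
    have tri: "d a b \<le> d a x1 + d x1 b" "d x1 b \<le> d x1 x' + d x' b"
      "d a b \<le> d a x' + d x' b" "d a x' \<le> d a x1 + d x1 x'"
      using d_triangle V V' by blast+
    have x1x'_eq: "d x1 x' = d x1 x + d x x'" using x1x' dab ax1 x'b tri by linarith
    have x1b: "d x1 b = d x1 x' + 1" using tri ax1 x'b dab x1x'_eq by linarith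
    have ax': "d a x' = d x1 x' + 1" using tri ax1 x'b dab x1x'_eq by linarith
    have x1R: "d z x1 = Suc R \<and> d z a = R"
    proof -
      have "d z x \<le> R" if "d z x1 \<le> R"
        by (rule less.hyps[of x1 b x R]) (use that V V' b x1b xb dab x1x'_eq in auto)
      with bad have "\<not> d z x1 \<le> R" by blast
      then show ?thesis using d_adj_le[OF x1(1) V(1)] a by simp
    qed
    have x'R: "d z x' = Suc R \<and> d z b = R"
    proof -
      have "d z x \<le> R" if "d z x' \<le> R"
        by (rule less.hyps[of a x' x R]) (use that V V' a ax' dab x1x'_eq x1(2) in auto)
      with bad have "\<not> d z x' \<le> R" by blast
      then show ?thesis using d_adj_le[OF x'(1) V(1)] b by simp
    qed
    show False
    proof (cases "x1 = x'")
      case True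
      then have dab2: "d a b = 2" using dab x1x'_eq by simp
      then have "a \<noteq> b" by auto
      have "adj b x1" using x'(1) True by simp
      have "adj a b"
        by (rule projection_clique[of z x1 R a b]) (use V x1(1) \<open>adj b x1\<close> x1R x'R \<open>a \<noteq> b\<close> in simp_all)
      then show False using d_adj dab2 by force
    next
      case False
      \<comment> \<open>\<open>x2\<close> follows some geodesic from \<open>x1\<close> to
        \<open>x'\<close>, which need not pass through \<open>x\<close>; from here on the
        contradiction concerns \<open>x1\<close> and \<open>x2\<close> alone.\<close>
      obtain x2 where x2: "adj x1 x2" "d x1 x' = d x2 x' + 1"
        using d_first_step[of x1 x'] V' False by blast
      have V2: "x2 \<in> V" using x2 adj_vertices by blast
      have x12: "d x1 x2 = 1" using x2 d_adj by simp
      have "d z x2 \<le> Suc R"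
        by (rule less.hyps[of x1 x' x2 "Suc R"]) (use V V' V2 x1R x'R x2 x12 dab x1x'_eq in auto)
      have x2b: "d x2 b = d x2 x' + 1"
        using d_triangle[of x2 x' b] d_triangle[of x1 x2 b] V V' V2 x'b x12 x1b x2(2)
        by linarith
      have ax2: "d a x2 = 2"
        using d_triangle[of a x1 x2] d_triangle[of a x2 x'] V V' V2 ax1 x12 ax' x2(2)
        by linarith
      have "d a b = d x2 x' + 3" using dab x1x'_eq x2(2) by simp
      have "d z x1 \<le> R" if "d z x2 \<le> R"
        by (rule less.hyps[of a x2 x1 R])
          (use that V V' V2 a ax2 ax1 x12 \<open>d a b = d x2 x' + 3\<close> in auto)
      then have "\<not> d z x2 \<le> R" using x1R by auto
      then have x2R: "d z x2 = Suc R" using \<open>d z x2 \<le> Suc R\<close> by simp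
      \<comment> \<open>The edge from \<open>x1\<close> to \<open>x2\<close> lies in the sphere of
        radius \<open>Suc R\<close>, so it has a common neighbor in the ball. This \<open>y\<close>
        can replace \<open>a\<close>: it is adjacent to \<open>a\<close>, and a geodesic from
        \<open>y\<close> to \<open>b\<close> through \<open>x2\<close> is shorter than the original
        one, which forces \<open>x2\<close> back into the ball.\<close>
      obtain y where y: "y \<in> V" "d z y \<le> R" "adj y x1" "adj y x2"
        by (rule projection_exists[of z "{x1, x2}" R])
          (use V edge_simplex[OF x2(1)] x1R x2R in auto)
      have "y \<noteq> a" using d_adj[OF y(4)] ax2 by auto
      have "adj a y"
        by (rule projection_clique[of z x1 R a y])
          (use V x1(1) x1R y \<open>y \<noteq> a\<close> in simp_all)
      have ab3: "d a b = d x2 b + 2" using \<open>d a b = d x2 x' + 3\<close> x2b by simp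
      have yb: "d y b = d x2 b + 1"
        using d_triangle[of y x2 b] d_triangle[of a y b] d_adj[OF \<open>adj a y\<close>] d_adj[OF y(4)] ab3 V y V2
        by linarith
      have "d z x2 \<le> R"
        by (rule less.hyps[of y b x2 R])
          (use V y V2 b d_adj[OF y(4)] ab3 yb in auto)
      then show False using x2R by simp
    qed
  qed
qed

section \<open>Descent towards a simplex\<close>

definition common_ball :: "'v set \<Rightarrow> nat \<Rightarrow> 'v set" where
  "common_ball \<sigma> n = {w \<in> V. \<forall>v\<in>\<sigma>. d v w \<le> n}"

lemma common_ball_mono: "m \<le> n \<Longrightarrow> common_ball \<sigma> m \<subseteq> common_ball \<sigma> n"
  unfolding common_ball_def by (auto intro: order_trans)

text \<open>Some vertex of \<open>\<sigma>\<close> is at distance exactly \<open>Suc n\<close> from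
  \<open>t\<close>, and its ball contains \<open>x\<close> and \<open>y\<close>, so the condition
  for a single ball suffices.\<close>

lemma common_ball_clique:
  assumes "\<sigma> \<subseteq> V" "t \<in> common_ball \<sigma> (Suc n)" "t \<notin> common_ball \<sigma> n"
    "x \<in> common_ball \<sigma> n" "y \<in> common_ball \<sigma> n" "adj x t" "adj y t" "x \<noteq> y"
  shows "adj x y"
proof -
  obtain v where v: "v \<in> \<sigma>" "\<not> d v t \<le> n"
    using assms(2,3) unfolding common_ball_def by blast
  have "d v t = Suc n" using v assms(2) unfolding common_ball_def by force
  then show ?thesis
    by (intro projection_clique[of v t n x y])
      (use assms v in \<open>auto simp: common_ball_def\<close>)
qed

text \<open>The roles are exchanged: descent is applied from \<open>t\<close> to the face
  \<open>\<rho>\<close> of \<open>\<sigma>\<close> farthest from \<open>t\<close>. The remaining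
  vertices of \<open>\<sigma>\<close> lie in the projection of \<open>\<rho>\<close> too, so any
  \<open>u\<close> in it is within distance 1 of all of \<open>\<sigma>\<close>, while
  \<open>d t u = n\<close>. The first step from \<open>t\<close> towards \<open>u\<close> is the
  vertex sought; \<open>n \<ge> 1\<close> ensures that there is such a step.\<close>

lemma common_ball_descent_vertex:
  assumes "\<sigma> \<in> K" "n \<ge> 1" "t \<in> common_ball \<sigma> (Suc n)" "t \<notin> common_ball \<sigma> n"
  obtains y where "y \<in> common_ball \<sigma> n" "adj y t"
proof -
  have t: "t \<in> V" "\<And>v. v \<in> \<sigma> \<Longrightarrow> d t v \<le> Suc n"
    using assms(3) d_sym unfolding common_ball_def by auto
  have \<sigma>: "\<sigma> \<subseteq> V" using simplex_subset assms(1) .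
  define \<rho> where "\<rho> = {v \<in> \<sigma>. d t v = Suc n}"
  obtain s where "s \<in> \<sigma>" "\<not> d s t \<le> n"
    using assms(3,4) unfolding common_ball_def by blast
  then have s: "s \<in> \<rho>" using t(2)[of s] d_sym[of s t] unfolding \<rho>_def by auto
  have "\<rho> \<subseteq> \<sigma>" unfolding \<rho>_def by blast
  then have "\<rho> \<in> K" using simplex_face[OF assms(1)] s by blast
  have proj: "{w \<in> V. d t w \<le> n \<and> (\<forall>u\<in>\<rho>. adj w u)} \<in> K" (is "?P \<in> K")
    by (rule projection_simplex) (use t \<open>\<rho> \<in> K\<close> in \<open>auto simp: \<rho>_def\<close>)
  then obtain u where u: "u \<in> ?P" using simplex_nonempty by blast
  have near: "d u v \<le> 1" if "v \<in> \<sigma>" for v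
  proof (cases "v \<in> \<rho>")
    case True
    then show ?thesis using u d_adj by fastforce
  next
    case False
    then have "d t v \<le> n" using t(2)[OF that] that unfolding \<rho>_def by auto
    moreover have "adj v w" if "w \<in> \<rho>" for w
    proof -
      have "v \<noteq> w" using False that by blast
      then show ?thesis using simplex_adj[OF assms(1)] \<open>v \<in> \<sigma>\<close> \<open>\<rho> \<subseteq> \<sigma>\<close> that by blast
    qed
    ultimately have "v \<in> ?P" using that \<sigma> by blast
    then have "u = v \<or> adj u v" using simplex_adj[OF proj u] by blast
    then show ?thesis using d_adj[of u v] d_refl[of u] by auto
  qed
  have uV: "u \<in> V" using u by blast
  have "d t s = Suc n" using s unfolding \<rho>_def by blast
  have sV: "s \<in> V" using s \<open>\<rho> \<subseteq> \<sigma>\<close> \<sigma> by blast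
  have "d t s \<le> d t u + d u s" using d_triangle t(1) uV sV by blast
  then have "d t u = n" using near[of s] u \<open>d t s = Suc n\<close> s \<open>\<rho> \<subseteq> \<sigma>\<close> by force
  then have "t \<noteq> u" using assms(2) by auto
  then obtain y where y: "adj t y" "d t u = d y u + 1"
    using d_first_step[OF t(1) uV] by blast
  have yV: "y \<in> V" using y(1) adj_vertices by blast
  have "d v y \<le> n" if "v \<in> \<sigma>" for v
  proof -
    have "d y v \<le> d y u + d u v" using d_triangle yV uV that \<sigma> by blast
    then show ?thesis using near[OF that] y(2) \<open>d t u = n\<close> d_sym[of v y] by linarith
  qed
  then have "y \<in> common_ball \<sigma> n" unfolding common_ball_def using yV by blast
  then show ?thesis using y(1) adj_sym that by blast
qed

text \<open>If \<open>y\<close> and \<open>y'\<close> serve only one end each, a common neighbor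
  \<open>x\<close> of \<open>t\<close> and \<open>t'\<close>, taken in the ball of a single vertex
  \<open>v\<close>, is adjacent to both. As \<open>x\<close> itself misses the common ball,
  \<open>y\<close> and \<open>y'\<close> are adjacent by \<open>common_ball_clique\<close>, and
  \<open>t\<close>, \<open>t'\<close>, \<open>y'\<close>, \<open>y\<close> form an induced
  4-cycle.\<close>

lemma common_ball_descent_edge:
  assumes "\<sigma> \<in> K" "n \<ge> 1" "adj t t'"
    and t: "t \<in> common_ball \<sigma> (Suc n)" "t \<notin> common_ball \<sigma> n"
    and t': "t' \<in> common_ball \<sigma> (Suc n)" "t' \<notin> common_ball \<sigma> n"
  shows "\<exists>y\<in>common_ball \<sigma> n. adj y t \<and> adj y t'"
proof (rule ccontr)
  assume "\<not> ?thesis"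
  then have none: "\<not> (adj y t \<and> adj y t')" if "y \<in> common_ball \<sigma> n" for y
    using that by blast
  have \<sigma>: "\<sigma> \<subseteq> V" using simplex_subset assms(1) .
  obtain y where y: "y \<in> common_ball \<sigma> n" "adj y t"
    using common_ball_descent_vertex[OF assms(1,2) t] .
  obtain y' where y': "y' \<in> common_ball \<sigma> n" "adj y' t'"
    using common_ball_descent_vertex[OF assms(1,2) t'] .
  have "\<not> adj y t'" "\<not> adj y' t" using none y y' by blast+
  have neq: "y \<noteq> t'" "y' \<noteq> t" using y y' t t' by blast+
  obtain v where v: "v \<in> \<sigma>" "\<not> d v t \<le> n" using t unfolding common_ball_def by blast
  have vV: "v \<in> V" using v \<sigma> by blast
  have vt: "d v t = Suc n" using v t(1) unfolding common_ball_def by force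
  have le: "d v t' \<le> Suc n" "d v y \<le> n" "d v y' \<le> n"
    using v t'(1) y(1) y'(1) unfolding common_ball_def by blast+
  have "adj t' y" if "d v t' \<le> n"
    by (rule projection_clique[of v t n]) (use vV vt adj_sym assms(3) y le that neq in auto)
  then have vt': "d v t' = Suc n" using le(1) \<open>\<not> adj y t'\<close> adj_sym by fastforce
  obtain x where x: "x \<in> V" "d v x \<le> n" "adj x t" "adj x t'"
    by (rule projection_exists[of v "{t, t'}" n]) (use vV edge_simplex[OF assms(3)] vt vt' in auto)
  have xy: "adj x y"
    by (rule projection_clique[of v t n]) (use vV vt x y le \<open>\<not> adj y t'\<close> in auto)
  have xy': "adj x y'"
    by (rule projection_clique[of v t' n]) (use vV vt' x y' le \<open>\<not> adj y' t\<close> in auto)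
  have "x \<notin> common_ball \<sigma> n" using none x by blast
  moreover have "x \<in> common_ball \<sigma> (Suc n)"
  proof -
    have "d w x \<le> Suc n" if "w \<in> \<sigma>" for w
    proof -
      have "d w x \<le> d w y + 1" using d_adj_le[of y x w] adj_sym[OF xy] that \<sigma> by blast
      moreover have "d w y \<le> n" using y(1) that unfolding common_ball_def by blast
      ultimately show ?thesis by simp
    qed
    then show ?thesis using x(1) unfolding common_ball_def by blast
  qed
  moreover have "y \<noteq> y'" using y \<open>\<not> adj y' t\<close> by blast
  ultimately have "adj y y'"
    using common_ball_clique[OF \<sigma>, of x n y y'] y y' adj_sym[OF xy] adj_sym[OF xy'] by blast
  then have "adj t y' \<or> adj t' y"
    using no_induced_C4[of t t' y' y] assms(3) adj_sym[OF \<open>adj y y'\<close>] adj_sym[OF y'(2)] y(2) neq by simp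
  then show False using \<open>\<not> adj y t'\<close> \<open>\<not> adj y' t\<close> adj_sym by blast
qed

text \<open>A vertex \<open>y\<close> of the common ball that sees as much of \<open>\<tau>\<close>
  as possible sees all of it: if \<open>t1\<close> is missed, the vertex \<open>z\<close> obtained
  from an edge of \<open>\<tau>\<close> at \<open>t1\<close> sees \<open>t1\<close> and, by the
  absence of induced 4-cycles, everything that \<open>y\<close> sees.\<close>

lemma common_ball_descent:
  assumes "\<sigma> \<in> K" "n \<ge> 1" "\<tau> \<in> K" "\<tau> \<subseteq> common_ball \<sigma> (Suc n) - common_ball \<sigma> n"
  shows "{y \<in> common_ball \<sigma> n. \<forall>t\<in>\<tau>. adj y t} \<in> K"
proof -
  have \<sigma>: "\<sigma> \<subseteq> V" using simplex_subset assms(1) .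
  have fin: "finite \<tau>" using simplex_finite assms(3) .
  have \<tau>: "t \<in> common_ball \<sigma> (Suc n)" "t \<notin> common_ball \<sigma> n" if "t \<in> \<tau>" for t
    using assms(4) that by auto
  obtain t where t: "t \<in> \<tau>" using simplex_nonempty assms(3) by blast
  obtain y1 where y1: "y1 \<in> common_ball \<sigma> n" "adj y1 t"
    using common_ball_descent_vertex[OF assms(1,2) \<tau>[OF t]] .
  let ?N = "\<lambda>y. {t \<in> \<tau>. adj y t}"
  let ?S = "{y \<in> common_ball \<sigma> n. ?N y \<noteq> {}}"
  have "y1 \<in> ?S" using y1 t by blast
  moreover have "\<forall>y. y \<in> ?S \<longrightarrow> card (?N y) < Suc (card \<tau>)"
    using card_mono[OF fin] by (simp add: less_Suc_eq_le)
  ultimately have "\<exists>y. y \<in> ?S \<and> (\<forall>z. z \<in> ?S \<longrightarrow> card (?N z) \<le> card (?N y))"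
    by (rule ex_has_greatest_nat[of "\<lambda>y. y \<in> ?S" y1 "\<lambda>y. card (?N y)" "Suc (card \<tau>)"])
  then obtain y where y: "y \<in> ?S" and max: "\<And>z. z \<in> ?S \<Longrightarrow> card (?N z) \<le> card (?N y)"
    by blast
  have all: "adj y t1" if t1: "t1 \<in> \<tau>" for t1
  proof (rule ccontr)
    assume n1: "\<not> adj y t1"
    obtain t0 where t0: "t0 \<in> \<tau>" "adj y t0" using y by blast
    have "t0 \<noteq> t1" using t0 n1 by blast
    then have "adj t0 t1" using simplex_adj[OF assms(3)] t0 t1 by blast
    then obtain z where z: "z \<in> common_ball \<sigma> n" "adj z t0" "adj z t1"
      using common_ball_descent_edge[OF assms(1,2) _ \<tau>[OF t0(1)] \<tau>[OF t1]] by blast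
    have "y \<noteq> z" using z n1 by blast
    have "y \<in> common_ball \<sigma> n" using y by blast
    then have "adj y z"
      using common_ball_clique[OF \<sigma> \<tau>[OF t0(1)], of y z] z t0 \<open>y \<noteq> z\<close> by blast
    have "adj z s" if "s \<in> \<tau>" "adj y s" for s
    proof -
      have "s \<noteq> t1" using that n1 by blast
      then have "adj t1 s" using simplex_adj[OF assms(3)] that t1 by blast
      moreover have "y \<noteq> t1" "z \<noteq> s" using \<open>y \<in> common_ball \<sigma> n\<close> z(1) \<tau> t1 that by blast+
      ultimately show ?thesis
        using no_induced_C4[of y z t1 s] \<open>adj y z\<close> z(3) adj_sym[OF that(2)] n1 by simp
    qed
    then have "?N y \<subset> ?N z" using z(3) t1 n1 by blast
    then have "card (?N y) < card (?N z)" using fin by (intro psubset_card_mono) auto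
    moreover have "z \<in> ?S" using z t0 by blast
    ultimately show False using max by fastforce
  qed
  show ?thesis
  proof (rule clique_simplex)
    show "{y \<in> common_ball \<sigma> n. \<forall>t\<in>\<tau>. adj y t} \<subseteq> V" unfolding common_ball_def by blast
    show "{y \<in> common_ball \<sigma> n. \<forall>t\<in>\<tau>. adj y t} \<noteq> {}" using y all by blast
    fix u w assume "u \<in> {y \<in> common_ball \<sigma> n. \<forall>t\<in>\<tau>. adj y t}"
      "w \<in> {y \<in> common_ball \<sigma> n. \<forall>t\<in>\<tau>. adj y t}" "u \<noteq> w"
    then show "adj u w"
      using common_ball_clique[OF \<sigma> \<tau>[OF t], of u w] t by blast
  qed
qed

lemma common_ball_exhausts:
  assumes "\<sigma> \<in> K" "finite F" "F \<subseteq> V"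
  obtains n where "F \<subseteq> common_ball \<sigma> (Suc n)"
proof
  let ?D = "(\<lambda>(v, w). d v w) ` (\<sigma> \<times> F)"
  have "finite ?D" using assms simplex_finite by auto
  then have "d v w \<le> Suc (Max (insert 0 ?D))" if "v \<in> \<sigma>" "w \<in> F" for v w
    using that by (intro le_SucI Max_ge) auto
  then show "F \<subseteq> common_ball \<sigma> (Suc (Max (insert 0 ?D)))"
    unfolding common_ball_def using assms(3) by blast
qed

text \<open>This makes the last stage of the contraction a straight segment: every simplex of the
  innermost layer spans a simplex together with the base.\<close>

lemma common_ball_1:
  assumes "\<sigma> \<in> K" "\<rho> \<in> K" "\<rho> \<subseteq> common_ball \<sigma> 1" shows "\<rho> \<union> \<sigma> \<in> K"
proof (rule clique_simplex)
  show "\<rho> \<union> \<sigma> \<subseteq> V" "\<rho> \<union> \<sigma> \<noteq> {}" using assms simplex_subset simplex_nonempty by blast+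
  have near: "adj v w" if "v \<in> \<sigma>" "w \<in> \<rho>" "v \<noteq> w" for v w
  proof -
    have "d v w \<le> 1" "v \<in> V" "w \<in> V"
      using that assms simplex_subset unfolding common_ball_def by blast+
    then show ?thesis using d_le_1 that(3) by blast
  qed
  fix u w assume "u \<in> \<rho> \<union> \<sigma>" "w \<in> \<rho> \<union> \<sigma>" "u \<noteq> w"
  then show "adj u w"
    using near adj_sym simplex_adj[OF assms(1)] simplex_adj[OF assms(2)] by blast
qed

end

section \<open>Invariant simplices of finite groups\<close>

text \<open>Restricting the maps to the vertices with maximal neighborhood, where \<open>f 1\<close> can only exchange
  twins, shortens the sequence by one.\<close>

lemma dismantlable_invariant_clique:
  fixes R :: "'a \<Rightarrow> 'a \<Rightarrow> bool"
  assumes "finite Y" "Y \<noteq> {}"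
    and refl: "\<And>x. x \<in> Y \<Longrightarrow> R x x"
    and sym: "\<And>x y. \<lbrakk>x \<in> Y; y \<in> Y; R x y\<rbrakk> \<Longrightarrow> R y x"
    and aut: "\<And>g. g \<in> A \<Longrightarrow> g ` Y = Y"
      "\<And>g x y. \<lbrakk>g \<in> A; x \<in> Y; y \<in> Y\<rbrakk> \<Longrightarrow> R (g x) (g y) \<longleftrightarrow> R x y"
    and f_in: "\<And>i x. x \<in> Y \<Longrightarrow> f i x \<in> Y"
    and f_0: "\<And>x. x \<in> Y \<Longrightarrow> f 0 x = x"
    and f_step: "\<And>i x y. \<lbrakk>i < n; x \<in> Y; y \<in> Y; R x y\<rbrakk> \<Longrightarrow> R (f i x) (f (Suc i) y)"
    and f_n: "\<And>x y. \<lbrakk>x \<in> Y; y \<in> Y\<rbrakk> \<Longrightarrow> R (f n x) (f n y)"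
  shows "\<exists>Q\<subseteq>Y. Q \<noteq> {} \<and> (\<forall>x\<in>Q. \<forall>y\<in>Q. R x y) \<and> (\<forall>g\<in>A. g ` Q \<subseteq> Q)"
  using assms
proof (induction n arbitrary: Y f)
  case 0
  show ?case
  proof (intro exI[of _ Y] conjI ballI)
    show "R x y" if "x \<in> Y" "y \<in> Y" for x y
      using 0(10)[OF that] 0(8)[OF that(1)] 0(8)[OF that(2)] by simp
    show "g ` Y \<subseteq> Y" if "g \<in> A" for g using 0(5)[OF that] by simp
  qed (use 0(2) in simp_all)
next
  case (Suc n)
  note refl = Suc.prems(3) and sym = Suc.prems(4) and autY = Suc.prems(5) and autR = Suc.prems(6)
    and f_in = Suc.prems(7) and f_0 = Suc.prems(8) and f_step = Suc.prems(9) and f_n = Suc.prems(10)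
  define N where "N x = {y \<in> Y. R x y}" for x
  \<comment> \<open>All dominating vertices are kept, with all their twins, instead of one
    representative per class. Hence \<open>M\<close> is determined by the graph and preserved by
    every automorphism.\<close>
  define M where "M = {x \<in> Y. \<forall>y\<in>Y. N x \<subseteq> N y \<longrightarrow> N y = N x}"
  have finN: "finite (N x)" for x unfolding N_def using Suc.prems(1) by simp
  have "\<exists>m\<in>M. N x \<subseteq> N m" if "x \<in> Y" for x
    using that
  proof (induction "card Y - card (N x)" arbitrary: x rule: less_induct)
    case less
    show ?case
    proof (cases "x \<in> M")
      case False
      then obtain y where y: "y \<in> Y" "N x \<subset> N y" unfolding M_def using less.prems by blast
      have "card (N x) < card (N y)" using y finN psubset_card_mono by blast
      moreover have "card (N y) \<le> card Y"
        using card_mono[OF Suc.prems(1), of "N y"] unfolding N_def by blast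
      ultimately have "card Y - card (N y) < card Y - card (N x)" by linarith
      then obtain m where "m \<in> M" "N y \<subseteq> N m" using less.hyps y(1) by blast
      then show ?thesis using y by blast
    qed blast
  qed
  then obtain r0 where r0: "\<And>x. x \<in> Y \<Longrightarrow> r0 x \<in> M \<and> N x \<subseteq> N (r0 x)" by metis
  \<comment> \<open>The retraction involves choices and need not commute with \<open>A\<close>. That
    is harmless, because it only transports the maps \<open>f\<close>, on which no invariance is
    imposed.\<close>
  define r where "r x = (if x \<in> M then x else r0 x)" for x
  have MY: "M \<subseteq> Y" unfolding M_def by blast
  have rM: "r x \<in> M" "N x \<subseteq> N (r x)" if "x \<in> Y" for x
    using r0[OF that] unfolding r_def by auto
  have r_id: "r x = x" if "x \<in> M" for x using that unfolding r_def by simp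
  have r_dom: "R (r x) y" if "x \<in> Y" "y \<in> Y" "R x y" for x y
    using rM(2)[OF that(1)] that unfolding N_def by blast
  have r_R: "R (r x) (r y)" if "x \<in> Y" "y \<in> Y" "R x y" for x y
    using r_dom[OF that] r_dom[of y "r x"] rM(1) MY sym that by blast
  \<comment> \<open>As \<open>f 0\<close> is the identity, \<open>f_step\<close> says that
    \<open>f 1 m\<close> is related to everything that \<open>m\<close> is related to; maximality of
    \<open>m\<close> turns this domination into equality.\<close>
  have twin: "N (f 1 m) = N m" if "m \<in> M" for m
  proof -
    have "R y (f 1 m)" if "y \<in> Y" "R m y" for y
      using f_step[of 0 y m] f_0[of y] that \<open>m \<in> M\<close> MY sym[of m y] by auto
    then have "N m \<subseteq> N (f 1 m)" using sym f_in \<open>m \<in> M\<close> MY unfolding N_def by blast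
    then show ?thesis using that f_in[of m 1] MY unfolding M_def by blast
  qed
  have f1_M: "f 1 m \<in> M" if "m \<in> M" for m
    using twin[OF that] that f_in MY unfolding M_def by auto
  have twin_R: "R m y \<longleftrightarrow> R (f 1 m) y" if "m \<in> M" "y \<in> Y" for m y
    using twin[OF that(1)] that(2) unfolding N_def by blast
  \<comment> \<open>Index 1 is skipped: on \<open>M\<close> the map \<open>f 1\<close> exchanges
    twins, so the identity can be followed directly by \<open>f 2\<close>, retracted to
    \<open>M\<close>.\<close>
  define h where "h i = (\<lambda>x. if i = 0 then x else r (f (Suc i) x))" for i :: nat
  have "\<exists>Q\<subseteq>M. Q \<noteq> {} \<and> (\<forall>x\<in>Q. \<forall>y\<in>Q. R x y) \<and> (\<forall>g\<in>A. g ` Q \<subseteq> Q)"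
  proof (rule Suc.IH[where f = h])
    show "finite M" using MY Suc.prems(1) finite_subset by blast
    show "M \<noteq> {}" using rM Suc.prems(2) by blast
    show "g ` M = M" if g: "g \<in> A" for g
    proof -
      have "inj_on g Y" using autY[OF g] Suc.prems(1) by (simp add: eq_card_imp_inj_on)
      have Ng: "N (g x) = g ` N x" if "x \<in> Y" for x
      proof (rule subset_antisym; rule subsetI)
        fix z assume "z \<in> N (g x)"
        then have z: "z \<in> Y" "R (g x) z" unfolding N_def by simp_all
        then obtain y where y: "y \<in> Y" "z = g y" using autY[OF g] by (metis imageE)
        then have "y \<in> N x" using autR[OF g that y(1)] z(2) unfolding N_def by simp
        then show "z \<in> g ` N x" using y(2) by blast
      next
        fix z assume "z \<in> g ` N x"
        then obtain y where y: "y \<in> Y" "z = g y" "R x y" unfolding N_def by blast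
        have "g y \<in> Y" using imageI[OF y(1), of g] autY[OF g] by simp
        then show "z \<in> N (g x)" using autR[OF g that y(1)] y(2,3) unfolding N_def by simp
      qed
      have "g x \<in> M" if "x \<in> M" for x
        unfolding M_def
      proof (intro CollectI conjI ballI impI)
        show "g x \<in> Y" using imageI[of x Y g] that MY autY[OF g] by auto
        fix y assume "y \<in> Y" and sub: "N (g x) \<subseteq> N y"
        then obtain z where z: "z \<in> Y" "y = g z" using autY[OF g] by (metis imageE)
        have "x \<in> Y" using that MY by blast
        then have "g ` N x \<subseteq> g ` N z" using sub Ng[of x] Ng[of z] z by simp
        moreover have "N x \<subseteq> Y" "N z \<subseteq> Y" unfolding N_def by blast+
        ultimately have "N x \<subseteq> N z"
          using \<open>inj_on g Y\<close> inj_on_image_subset_iff by metis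
        then have "N z = N x" using that z unfolding M_def by blast
        then show "N y = N (g x)" using Ng z that MY by auto
      qed
      then have "g ` M \<subseteq> M" by blast
      moreover have "card (g ` M) = card M"
        using \<open>inj_on g Y\<close> MY card_image inj_on_subset by blast
      ultimately show ?thesis using \<open>finite M\<close> by (simp add: card_subset_eq)
    qed
    show "h i x \<in> M" if "x \<in> M" for i x
      using that rM(1) f_in MY unfolding h_def by auto
    show "h 0 x = x" for x unfolding h_def by simp
    show "R (h i x) (h (Suc i) y)" if i: "i < n" and xy: "x \<in> M" "y \<in> M" "R x y" for i x y
    proof (cases "i = 0")
      case True
      have "R (f 1 x) (f 2 y)"
        using f_step[of 1 x y] xy i MY by (auto simp: numeral_2_eq_2)
      then have "R x (f 2 y)" using twin_R[of x "f 2 y"] xy f_in MY by blast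
      then have "R (r x) (r (f 2 y))" using r_R xy f_in MY by blast
      then show ?thesis unfolding h_def using True r_id xy by (simp add: numeral_2_eq_2)
    next
      case False
      have "R (f (Suc i) x) (f (Suc (Suc i)) y)" using f_step[of "Suc i" x y] xy i MY by auto
      moreover have "f (Suc i) x \<in> Y" "f (Suc (Suc i)) y \<in> Y" using f_in xy MY by blast+
      ultimately show ?thesis unfolding h_def using False r_R by simp
    qed
    show "R (h n x) (h n y)" if "x \<in> M" "y \<in> M" for x y
    proof (cases "n = 0")
      case True
      have "R (f 1 x) (f 1 y)" using f_n[of x y] that MY True by auto
      then have "R x (f 1 y)" using twin_R that f_in MY by blast
      then have "R (f 1 y) x" using sym that f_in MY by blast
      then have "R y x" using twin_R that MY by blast
      then show ?thesis unfolding h_def using True sym that MY by auto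
    next
      case False
      have "R (f (Suc n) x) (f (Suc n) y)" "f (Suc n) x \<in> Y" "f (Suc n) y \<in> Y"
        using f_n f_in that MY by blast+
      then show ?thesis unfolding h_def using False r_R by simp
    qed
    show "R x x" if "x \<in> M" for x using refl that MY by blast
    show "R y x" if "x \<in> M" "y \<in> M" "R x y" for x y using sym[of x y] that MY by blast
    show "R (g x) (g y) \<longleftrightarrow> R x y" if "g \<in> A" "x \<in> M" "y \<in> M" for g x y
      using autR[OF that(1), of x y] that(2,3) MY by blast
  qed
  then obtain Q where "Q \<subseteq> M \<and> Q \<noteq> {} \<and> (\<forall>x\<in>Q. \<forall>y\<in>Q. R x y) \<and> (\<forall>g\<in>A. g ` Q \<subseteq> Q)" ..
  then show ?case using subset_trans[OF _ MY, of Q] by (intro exI[of _ Q]) simp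
qed

text \<open>If \<open>a\<close> and \<open>b\<close> witness the failure of both inclusions, then
  \<open>d w b = d w a + 1\<close>, so \<open>a\<close> lies on a geodesic from \<open>w\<close> to
  \<open>b\<close>. Both ends are in the ball of radius \<open>n\<close> around \<open>w'\<close>,
  hence so is \<open>a\<close> by convexity.\<close>

lemma (in weakly_systolic_complex) clique_metric_trace_comparable:
  assumes "\<sigma> \<in> K" "w \<in> V" "w' \<in> V" "d w w' \<le> n"
  shows "{s \<in> \<sigma>. d w s \<le> n} \<subseteq> {s \<in> \<sigma>. d w' s \<le> n} \<or> {s \<in> \<sigma>. d w' s \<le> n} \<subseteq> {s \<in> \<sigma>. d w s \<le> n}"
proof (rule ccontr)
  assume "\<not> ?thesis"
  then obtain a b where a: "a \<in> \<sigma>" "d w a \<le> n" "\<not> d w' a \<le> n"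
    and b: "b \<in> \<sigma>" "d w' b \<le> n" "\<not> d w b \<le> n" by blast
  have V: "a \<in> V" "b \<in> V" using a b simplex_subset[OF assms(1)] by blast+
  have "a \<noteq> b" using a b by blast
  then have "adj a b" using simplex_adj[OF assms(1)] a b by blast
  then have "d w b \<le> d w a + 1" using d_adj_le assms(2) by blast
  moreover have "d a b = 1" using d_adj \<open>adj a b\<close> .
  ultimately have "d w a + d a b = d w b" using a b by linarith
  moreover have "d w' w \<le> n" using assms(4) d_sym[of w' w] by simp
  ultimately have "d w' a \<le> n" using ball_convex[of w' w b a n] assms V b by blast
  then show False using a by blast
qed

text \<open>The group axioms are imposed on \<open>V\<close> only; values outside \<open>V\<close> are irrelevant.\<close>

locale invariant_family = weakly_systolic_complex K for K :: "'v set set" +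
  fixes \<G> :: "('v \<Rightarrow> 'v) set"
  assumes finite_family: "finite \<G>"
    and bij: "\<And>g. g \<in> \<G> \<Longrightarrow> bij_betw g V V"
    and image_simplex: "\<And>g \<sigma>. \<lbrakk>g \<in> \<G>; \<sigma> \<in> K\<rbrakk> \<Longrightarrow> g ` \<sigma> \<in> K"
    and comp_family: "\<And>g h. \<lbrakk>g \<in> \<G>; h \<in> \<G>\<rbrakk> \<Longrightarrow> \<exists>k\<in>\<G>. \<forall>v\<in>V. k v = g (h v)"
    and inv_family: "\<And>g. g \<in> \<G> \<Longrightarrow> \<exists>k\<in>\<G>. \<forall>v\<in>V. k (g v) = v \<and> g (k v) = v"
    and id_family: "\<exists>k\<in>\<G>. \<forall>v\<in>V. k v = v"
begin

lemma image_vertex: "\<lbrakk>g \<in> \<G>; v \<in> V\<rbrakk> \<Longrightarrow> g v \<in> V"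
  using bij bij_betwE by blast

lemma image_adj: "\<lbrakk>g \<in> \<G>; adj u w\<rbrakk> \<Longrightarrow> adj (g u) (g w)"
proof -
  assume g: "g \<in> \<G>" and uw: "adj u w"
  then have "g u \<noteq> g w"
    using bij[OF g] adj_neq[OF uw] adj_vertices[OF uw] by (auto simp: bij_betw_def inj_on_def)
  moreover have "{g u, g w} \<in> K" using image_simplex[OF g edge_simplex[OF uw]] by simp
  ultimately show ?thesis unfolding edge_rel_def by simp
qed

lemma image_adj_iff:
  assumes "g \<in> \<G>" "u \<in> V" "w \<in> V" shows "adj (g u) (g w) \<longleftrightarrow> adj u w"
  using image_adj[OF assms(1)] inv_family[OF assms(1)] image_adj assms by metis

lemma image_d_le: "\<lbrakk>g \<in> \<G>; u \<in> V; w \<in> V\<rbrakk> \<Longrightarrow> d (g u) (g w) \<le> d u w"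
proof -
  assume g: "g \<in> \<G>" and V: "u \<in> V" "w \<in> V"
  have "(g u, g w) \<in> edge_rel K ^^ n" if "(u, w) \<in> edge_rel K ^^ n" for n
    using that
  proof (induction n arbitrary: w)
    case (Suc n)
    then show ?case using image_adj[OF g] by (auto simp: relcomp_unfold)
  qed auto
  then show ?thesis using walk_d[OF V] d_le_walk by blast
qed

lemma image_d: "\<lbrakk>g \<in> \<G>; u \<in> V; w \<in> V\<rbrakk> \<Longrightarrow> d (g u) (g w) = d u w"
  using image_d_le inv_family image_vertex by (metis le_antisym)

definition invariant :: "'v set \<Rightarrow> bool" where
  "invariant Q \<longleftrightarrow> Q \<subseteq> V \<and> (\<forall>g\<in>\<G>. g ` Q \<subseteq> Q)"

lemma invariant_image:
  assumes "invariant Q" "g \<in> \<G>" shows "g ` Q = Q"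
proof -
  obtain k where k: "k \<in> \<G>" "\<And>v. v \<in> V \<Longrightarrow> g (k v) = v" using inv_family assms(2) by blast
  have "v \<in> g ` Q" if "v \<in> Q" for v
  proof -
    have "k v \<in> Q" "v \<in> V" using assms(1) k(1) that unfolding invariant_def by blast+
    then show ?thesis using k(2) by (metis image_eqI)
  qed
  then have "Q \<subseteq> g ` Q" by blast
  then show ?thesis using assms unfolding invariant_def by blast
qed

lemma invariant_reduce_diameter:
  assumes fd: "finite_dimensional K"
    and Q: "finite Q" "Q \<noteq> {}" "invariant Q" "\<And>x y. \<lbrakk>x \<in> Q; y \<in> Q\<rbrakk> \<Longrightarrow> d x y \<le> Suc n" and n: "n \<ge> 1"
  shows "\<exists>Q'. finite Q' \<and> Q' \<noteq> {} \<and> invariant Q' \<and> (\<forall>x\<in>Q'. \<forall>y\<in>Q'. d x y \<le> n)"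
proof -
  have QV: "Q \<subseteq> V" using Q unfolding invariant_def by blast
  \<comment> \<open>\<open>B\<close> consists of the centers of the balls of radius
    \<open>Suc n\<close> that contain \<open>Q\<close>, and \<open>X\<close> is the intersection of
    these balls. The points of \<open>Q\<close> are such centers, hence \<open>X\<close> is
    contained in \<open>B\<close>, and this bounds the diameter of \<open>X\<close>.\<close>
  define B where "B = {z \<in> V. \<forall>o'\<in>Q. d z o' \<le> Suc n}"
  define X where "X = {x \<in> V. \<forall>z\<in>B. d z x \<le> Suc n}"
  have QB: "Q \<subseteq> B" unfolding B_def using Q(4) QV by blast
  have QX: "Q \<subseteq> X" unfolding X_def B_def using QV by blast
  have XB: "X \<subseteq> B"
  proof
    fix x assume "x \<in> X"
    then have "d x o' \<le> Suc n" if "o' \<in> Q" for o'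
      using QB that d_sym[of x o'] unfolding X_def by auto
    then show "x \<in> B" using \<open>x \<in> X\<close> unfolding B_def X_def by blast
  qed
  have XV: "X \<subseteq> V" unfolding X_def by blast
  have dX: "d x y \<le> Suc n" if "x \<in> X" "y \<in> X" for x y
    using that XB unfolding X_def by blast
  have convX: "u \<in> X" if "a \<in> X" "b \<in> X" "u \<in> V" "d a u + d u b = d a b" for a b u
    unfolding X_def
  proof (intro CollectI conjI ballI)
    fix z assume "z \<in> B"
    then show "d z u \<le> Suc n"
      using ball_convex[of z a b u "Suc n"] that unfolding X_def B_def by blast
  qed (rule that)
  have inv_le: "d z (g x) \<le> m" if "g \<in> \<G>" "k \<in> \<G>" "\<forall>v\<in>V. k (g v) = v \<and> g (k v) = v"
    "z \<in> V" "x \<in> V" "d (k z) x \<le> m" for g k z x m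
    using image_d[of g "k z" x] that image_vertex by auto
  have invB: "g z \<in> B" if "g \<in> \<G>" "z \<in> B" for g z
  proof -
    obtain k where k: "k \<in> \<G>" "\<forall>v\<in>V. k (g v) = v \<and> g (k v) = v" using inv_family[OF \<open>g \<in> \<G>\<close>] by blast
    have "d o' (g z) \<le> Suc n" if "o' \<in> Q" for o'
    proof (rule inv_le[OF \<open>g \<in> \<G>\<close> k])
      have "k o' \<in> Q" using Q(3) k(1) that unfolding invariant_def by blast
      then show "d (k o') z \<le> Suc n" using \<open>z \<in> B\<close> d_sym unfolding B_def by fastforce
      show "o' \<in> V" "z \<in> V" using that \<open>z \<in> B\<close> QV unfolding B_def by blast+
    qed
    then show ?thesis unfolding B_def using that image_vertex d_sym by (auto simp: B_def)
  qed
  have invX: "g x \<in> X" if "g \<in> \<G>" "x \<in> X" for g x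
  proof -
    obtain k where k: "k \<in> \<G>" "\<forall>v\<in>V. k (g v) = v \<and> g (k v) = v" using inv_family[OF \<open>g \<in> \<G>\<close>] by blast
    have "d z (g x) \<le> Suc n" if "z \<in> B" for z
    proof (rule inv_le[OF \<open>g \<in> \<G>\<close> k])
      show "d (k z) x \<le> Suc n" using invB[OF k(1) that] \<open>x \<in> X\<close> unfolding X_def by blast
      show "z \<in> V" "x \<in> V" using that \<open>x \<in> X\<close> XV unfolding B_def by blast+
    qed
    then show ?thesis unfolding X_def using that image_vertex XV by blast
  qed
  obtain q where q: "q \<in> Q" using Q by blast
  obtain D where D: "\<And>\<sigma>. \<sigma> \<in> K \<Longrightarrow> card \<sigma> \<le> Suc D" using fd unfolding finite_dimensional_def by blast
  have "\<exists>\<sigma>. (\<sigma> \<in> K \<and> \<sigma> \<subseteq> X) \<and> (\<forall>\<tau>. (\<tau> \<in> K \<and> \<tau> \<subseteq> X) \<longrightarrow> card \<tau> \<le> card \<sigma>)"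
    by (rule ex_has_greatest_nat[of _ "{q}" card "Suc (Suc D)"])
      (use q QX QV vertex_simplex D in \<open>auto simp: less_Suc_eq_le\<close>)
  then obtain \<sigma> where \<sigma>: "\<sigma> \<in> K" "\<sigma> \<subseteq> X" and max: "\<And>\<tau>. \<lbrakk>\<tau> \<in> K; \<tau> \<subseteq> X\<rbrakk> \<Longrightarrow> card \<tau> \<le> card \<sigma>"
    by blast
  define T where "T w = {s \<in> \<sigma>. d w s \<le> n}" for w
  have fin\<sigma>: "finite \<sigma>" using \<sigma> simplex_finite by blast
  have T_ne: "T w \<noteq> {}" if w: "w \<in> X" for w
  proof
    assume "T w = {}"
    have eq: "d w s = Suc n" if "s \<in> \<sigma>" for s
    proof -
      have "\<not> d w s \<le> n" using that \<open>T w = {}\<close> unfolding T_def by blast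
      moreover have "d w s \<le> Suc n" using dX w \<sigma>(2) that by blast
      ultimately show ?thesis by simp
    qed
    \<comment> \<open>The projection of \<open>\<sigma>\<close> seen from \<open>w\<close> lies on
      geodesics from \<open>w\<close> to \<open>\<sigma>\<close>, so convexity keeps
      \<open>z\<close> inside \<open>X\<close>, where it enlarges \<open>\<sigma>\<close>.\<close>
    obtain z where z: "z \<in> V" "d w z \<le> n" "\<And>s. s \<in> \<sigma> \<Longrightarrow> adj z s"
      by (rule projection_exists[of w \<sigma> n]) (use w XV \<sigma>(1) eq in auto)
    obtain s where s: "s \<in> \<sigma>" using simplex_nonempty[OF \<sigma>(1)] by blast
    have "d w s \<le> d w z + 1" using d_adj_le[OF z(3)[OF s]] w XV by blast
    then have "d w z + d z s = d w s" using z(2) eq[OF s] d_adj[OF z(3)[OF s]] by linarith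
    then have "z \<in> X" using convX[of w s z] w \<sigma>(2) s z(1) by blast
    have "z \<notin> \<sigma>" using z adj_neq by blast
    have "insert z \<sigma> \<in> K"
    proof (rule clique_simplex)
      show "insert z \<sigma> \<subseteq> V" using z(1) simplex_subset[OF \<sigma>(1)] by blast
      fix u w assume "u \<in> insert z \<sigma>" "w \<in> insert z \<sigma>" "u \<noteq> w"
      then show "adj u w" using z(3) adj_sym simplex_adj[OF \<sigma>(1)] by blast
    qed simp
    then have "card (insert z \<sigma>) \<le> card \<sigma>" using max \<open>z \<in> X\<close> \<sigma>(2) by blast
    then show False using fin\<sigma> \<open>z \<notin> \<sigma>\<close> by simp
  qed
  \<comment> \<open>\<open>X\<close> may be infinite. The orbit of \<open>\<sigma>\<close> is a
    finite invariant part of it that contains \<open>\<sigma>\<close>, towards which everything will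
    be collapsed.\<close>
  define Y where "Y = (\<Union>g\<in>\<G>. g ` \<sigma>)"
  have finY: "finite Y" unfolding Y_def using finite_family fin\<sigma> by blast
  have YX: "Y \<subseteq> X" unfolding Y_def using invX \<sigma>(2) by blast
  have YV: "Y \<subseteq> V" using YX XV by blast
  have \<sigma>Y: "\<sigma> \<subseteq> Y"
  proof
    fix s assume "s \<in> \<sigma>"
    obtain k where "k \<in> \<G>" "\<forall>v\<in>V. k v = v" using id_family by blast
    then have "s = k s" using \<open>s \<in> \<sigma>\<close> simplex_subset[OF \<sigma>(1)] by auto
    then show "s \<in> Y" unfolding Y_def using \<open>k \<in> \<G>\<close> \<open>s \<in> \<sigma>\<close> by blast
  qed
  have "g x \<in> Y" if g: "g \<in> \<G>" and "x \<in> Y" for g x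
  proof -
    obtain h s where h: "h \<in> \<G>" "s \<in> \<sigma>" "x = h s" using \<open>x \<in> Y\<close> unfolding Y_def by blast
    obtain k where k: "k \<in> \<G>" "\<forall>v\<in>V. k v = g (h v)" using comp_family[OF g h(1)] by blast
    then have "g x = k s" using h simplex_subset[OF \<sigma>(1)] by auto
    then show ?thesis unfolding Y_def using k(1) h(2) by blast
  qed
  then have invY: "invariant Y" unfolding invariant_def using YV by blast
  define p where "p w = (SOME s. s \<in> T w)" for w
  have p: "p w \<in> T w" if "w \<in> X" for w unfolding p_def using T_ne[OF that] some_in_eq by blast
  have p\<sigma>: "p w \<in> \<sigma>" if "w \<in> X" for w using p[OF that] unfolding T_def by blast
  have T_mono: "T w \<subseteq> T w'" if "w \<in> X" "w' \<in> X" "d w w' \<le> n" "card (T w) \<le> card (T w')" for w w'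
  proof -
    have fin: "finite (T w)" "finite (T w')" unfolding T_def using fin\<sigma> by auto
    have "T w \<subseteq> T w' \<or> T w' \<subseteq> T w"
      unfolding T_def by (rule clique_metric_trace_comparable) (use \<sigma>(1) that XV in auto)
    then show ?thesis using card_seteq[OF fin(1), of "T w'"] that(4) by blast
  qed
  have d\<sigma>: "d a b \<le> n" if "a \<in> \<sigma>" "b \<in> \<sigma>" for a b
  proof (cases "a = b")
    case False
    then show ?thesis using simplex_adj[OF \<sigma>(1) that] d_adj n by force
  qed simp
  \<comment> \<open>Vertices are collapsed into \<open>\<sigma>\<close> in order of increasing size
    of their traces. Related vertices have nested traces, so a vertex chosen in the smaller trace is
    also near the vertex with the larger one.\<close>
  define f where "f k w = (if card (T w) \<le> k then p w else w)" for k w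
  have "\<exists>Q'\<subseteq>Y. Q' \<noteq> {} \<and> (\<forall>x\<in>Q'. \<forall>y\<in>Q'. d x y \<le> n) \<and> (\<forall>g\<in>\<G>. g ` Q' \<subseteq> Q')"
  proof (rule dismantlable_invariant_clique[where f = f and n = "card \<sigma>"])
    show "finite Y" by (rule finY)
    show "Y \<noteq> {}" using \<sigma>Y simplex_nonempty[OF \<sigma>(1)] by blast
    show "d y x \<le> n" if "d x y \<le> n" for x y using that d_sym by metis
    show "g ` Y = Y" if "g \<in> \<G>" for g using invariant_image invY that by blast
    show "d (g x) (g y) \<le> n \<longleftrightarrow> d x y \<le> n" if "g \<in> \<G>" "x \<in> Y" "y \<in> Y" for g x y
      using image_d[of g x y] that YV by (simp add: subset_iff)
    show "f i x \<in> Y" if "x \<in> Y" for i x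
      unfolding f_def using that p\<sigma> YX \<sigma>Y by auto
    have "card (T x) \<noteq> 0" if "x \<in> X" for x
      using T_ne[OF that] fin\<sigma> unfolding T_def by simp
    then show "f 0 x = x" if "x \<in> Y" for x
      unfolding f_def using that YX by fastforce
    have to_p: "d (p x) y \<le> n" if "x \<in> X" "y \<in> X" "d x y \<le> n" "card (T x) \<le> card (T y)" for x y
    proof -
      have "p x \<in> T y" using T_mono[OF that] p[OF that(1)] by blast
      then show ?thesis unfolding T_def using d_sym[of y "p x"] by simp
    qed
    \<comment> \<open>If exactly one of the two vertices is moved, it has the smaller or an equally
      large trace. The critical case is \<open>y\<close> moved and \<open>x\<close> not: then
      \<open>card (T y) \<le> Suc i \<le> card (T x)\<close>, so the shift of the index by one does
      no harm.\<close>
    show "d (f i x) (f (Suc i) y) \<le> n" if xy: "x \<in> Y" "y \<in> Y" "d x y \<le> n" for i x y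
    proof -
      have X: "x \<in> X" "y \<in> X" using xy YX by blast+
      have yx: "d y x \<le> n" using xy(3) d_sym[of x y] by simp
      have "d (p x) (p y) \<le> n" using d\<sigma> p\<sigma> X by blast
      moreover have "d (p x) y \<le> n" if "card (T x) \<le> card (T y)" using to_p X xy(3) that by blast
      moreover have "d x (p y) \<le> n" if "card (T y) \<le> card (T x)"
        using to_p[OF X(2,1) yx that] d_sym[of x "p y"] by simp
      ultimately show ?thesis unfolding f_def using xy(3) by auto
    qed
    show "d (f (card \<sigma>) x) (f (card \<sigma>) y) \<le> n" if "x \<in> Y" "y \<in> Y" for x y
    proof -
      have "card (T w) \<le> card \<sigma>" for w unfolding T_def using card_mono[OF fin\<sigma>] by simp
      moreover have "p x \<in> \<sigma>" "p y \<in> \<sigma>" using p\<sigma> that YX by blast+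
      ultimately show ?thesis unfolding f_def using d\<sigma> by simp
    qed
  qed simp
  then obtain Q' where "Q' \<subseteq> Y" "Q' \<noteq> {}" "\<forall>x\<in>Q'. \<forall>y\<in>Q'. d x y \<le> n" "\<forall>g\<in>\<G>. g ` Q' \<subseteq> Q'"
    by blast
  then show ?thesis unfolding invariant_def using YV finY finite_subset by (intro exI[of _ Q']) blast
qed

theorem invariant_simplex:
  assumes fd: "finite_dimensional K"
  shows "\<exists>\<sigma>\<in>K. \<forall>g\<in>\<G>. g ` \<sigma> = \<sigma>"
proof -
  let ?P = "\<lambda>n. \<exists>Q. finite Q \<and> Q \<noteq> {} \<and> invariant Q \<and> (\<forall>x\<in>Q. \<forall>y\<in>Q. d x y \<le> n)"
  obtain v where v: "v \<in> V" using connected unfolding connected_1_skeleton_def by blast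
  define O1 where "O1 = (\<lambda>g. g v) ` \<G>"
  have "finite O1" unfolding O1_def using finite_family by simp
  moreover have "O1 \<noteq> {}" unfolding O1_def using id_family by blast
  moreover have "invariant O1"
    unfolding invariant_def
  proof (intro conjI ballI subsetI)
    show "x \<in> V" if "x \<in> O1" for x using that image_vertex v unfolding O1_def by blast
    fix g x assume g: "g \<in> \<G>" "x \<in> g ` O1"
    then obtain h where h: "h \<in> \<G>" "x = g (h v)" unfolding O1_def by blast
    then obtain k where "k \<in> \<G>" "\<forall>v\<in>V. k v = g (h v)" using comp_family[OF g(1) h(1)] by blast
    then have "k \<in> \<G>" "x = k v" using h v by auto
    then show "x \<in> O1" unfolding O1_def by blast
  qed
  moreover have "d x y \<le> Max ((\<lambda>(x, y). d x y) ` (O1 \<times> O1))" if "x \<in> O1" "y \<in> O1" for x y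
    using \<open>finite O1\<close> that by (intro Max_ge) auto
  ultimately have "\<exists>n. ?P n" by blast
  then have "?P (LEAST n. ?P n)" by (rule LeastI_ex)
  moreover have "(LEAST n. ?P n) \<le> 1"
  proof (rule ccontr)
    assume "\<not> ?thesis"
    then obtain n where n: "(LEAST n. ?P n) = Suc n" "n \<ge> 1" by (cases "LEAST n. ?P n") auto
    have "?P (Suc n)" using \<open>?P (LEAST n. ?P n)\<close> n(1) by metis
    then have "?P n" using invariant_reduce_diameter[OF fd _ _ _ _ n(2)] by blast
    then have "(LEAST n. ?P n) \<le> n" by (rule Least_le)
    then show False using n by simp
  qed
  ultimately obtain Q where Q: "Q \<noteq> {}" "invariant Q" "\<And>x y. \<lbrakk>x \<in> Q; y \<in> Q\<rbrakk> \<Longrightarrow> d x y \<le> 1"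
    by (meson order_trans)
  have QV: "Q \<subseteq> V" using Q(2) unfolding invariant_def by blast
  have "Q \<in> K"
  proof (rule clique_simplex)
    fix u w assume "u \<in> Q" "w \<in> Q" "u \<noteq> w"
    then show "adj u w" using Q(3)[of u w] d_le_1[of u w] QV by blast
  qed (use Q QV in auto)
  then show ?thesis using invariant_image Q(2) by blast
qed

end

section \<open>The weak topology\<close>

lemma realized_simplex_mono:
  assumes "finite \<tau>" "\<sigma> \<subseteq> \<tau>" shows "realized_simplex \<sigma> \<subseteq> realized_simplex \<tau>"
proof
  fix x assume x: "x \<in> realized_simplex \<sigma>"
  then have "(\<Sum>v\<in>\<tau>. x v) = (\<Sum>v\<in>\<sigma>. x v)"
    using assms by (intro sum.mono_neutral_right) (auto simp: realized_simplex_def)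
  then show "x \<in> realized_simplex \<tau>" using x assms unfolding realized_simplex_def by auto
qed

lemma realized_simplex_support:
  assumes "finite \<sigma>" "x \<in> realized_simplex \<sigma>"
  shows "{v. x v \<noteq> 0} \<subseteq> \<sigma>" "{v. x v \<noteq> 0} \<noteq> {}" "x \<in> realized_simplex {v. x v \<noteq> 0}"
proof -
  show sub: "{v. x v \<noteq> 0} \<subseteq> \<sigma>" using assms unfolding realized_simplex_def by auto
  have eq: "(\<Sum>v\<in>{v. x v \<noteq> 0}. x v) = (\<Sum>v\<in>\<sigma>. x v)"
    using assms sub by (intro sum.mono_neutral_left) auto
  then show "x \<in> realized_simplex {v. x v \<noteq> 0}"
    using assms unfolding realized_simplex_def by auto
  have "(\<Sum>v\<in>\<sigma>. x v) = 1" using assms unfolding realized_simplex_def by blast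
  then show "{v. x v \<noteq> 0} \<noteq> {}" using eq by (metis sum.empty zero_neq_one)
qed

lemma in_realization_iff:
  assumes "simplicial_complex K"
  shows "x \<in> topspace (realization K) \<longleftrightarrow> {v. x v \<noteq> 0} \<in> K \<and> x \<in> realized_simplex {v. x v \<noteq> 0}"
proof
  assume "x \<in> topspace (realization K)"
  then obtain \<sigma> where \<sigma>: "\<sigma> \<in> K" "x \<in> realized_simplex \<sigma>" unfolding topspace_realization by blast
  then have "finite \<sigma>" using assms unfolding simplicial_complex_def by blast
  note s = realized_simplex_support[OF this \<sigma>(2)]
  then show "{v. x v \<noteq> 0} \<in> K \<and> x \<in> realized_simplex {v. x v \<noteq> 0}"
    using assms \<sigma>(1) unfolding simplicial_complex_def by blast
qed (auto simp: topspace_realization)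

lemma closed_realized_simplex:
  fixes \<sigma> :: "'v set" shows "closed (realized_simplex \<sigma>)"
proof -
  have "realized_simplex \<sigma> = (\<Inter>v. {x. 0 \<le> x v}) \<inter> (\<Inter>v\<in>-\<sigma>. {x. x v = 0}) \<inter> {x. (\<Sum>v\<in>\<sigma>. x v) = 1}"
    unfolding realized_simplex_def by auto
  moreover have "closed (\<Inter>v. {x::'v \<Rightarrow> real. 0 \<le> x v})"
    by (intro closed_INT ballI closed_Collect_le continuous_intros) auto
  moreover have "closed (\<Inter>v\<in>-\<sigma>. {x::'v \<Rightarrow> real. x v = 0})"
    by (intro closed_INT ballI closed_Collect_eq continuous_intros) auto
  moreover have "closed {x::'v \<Rightarrow> real. (\<Sum>v\<in>\<sigma>. x v) = 1}"
    by (intro closed_Collect_eq continuous_intros) auto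
  ultimately show ?thesis by (simp add: closed_Int)
qed

lemma closedin_realization_simplex:
  assumes "closedin (realization K) C" "\<sigma> \<in> K"
  shows "closed (C \<inter> realized_simplex \<sigma>)"
proof -
  have "openin (top_of_set (realized_simplex \<sigma>))
      ((topspace (realization K) - C) \<inter> realized_simplex \<sigma>)"
    using assms unfolding closedin_def openin_realization by blast
  then have "closedin (top_of_set (realized_simplex \<sigma>))
      (realized_simplex \<sigma> - (topspace (realization K) - C) \<inter> realized_simplex \<sigma>)"
    by (intro closedin_diff closedin_topspace[of "top_of_set _", simplified]) auto
  moreover have "realized_simplex \<sigma> - (topspace (realization K) - C) \<inter> realized_simplex \<sigma>
      = C \<inter> realized_simplex \<sigma>"
    using assms(2) unfolding topspace_realization by blast
  ultimately show ?thesis using closed_realized_simplex closedin_closed_trans by metis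
qed

text \<open>Supports in one finite set \<open>F\<close> confine the map to finitely many closed
  simplices, so the preimage of a closed set is a finite union of closed sets.\<close>

lemma continuous_map_into_realization:
  fixes f :: "'a::topological_space \<Rightarrow> 'v \<Rightarrow> real"
  assumes K: "simplicial_complex K"
    and cont: "\<And>v. continuous_on S (\<lambda>z. f z v)"
    and F: "finite F" "\<And>z v. \<lbrakk>z \<in> S; f z v \<noteq> 0\<rbrakk> \<Longrightarrow> v \<in> F"
    and f: "\<And>z. z \<in> S \<Longrightarrow> f z \<in> topspace (realization K)"
  shows "continuous_map (top_of_set S) (realization K) f"
  unfolding continuous_map_closedin
proof (intro conjI allI impI)
  fix C assume C: "closedin (realization K) C"
  let ?T = "{\<tau> \<in> K. \<tau> \<subseteq> F}"
  have "{z \<in> topspace (top_of_set S). f z \<in> C} = (\<Union>\<tau>\<in>?T. S \<inter> f -` (C \<inter> realized_simplex \<tau>))"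
  proof (intro subset_antisym subsetI)
    fix z assume z: "z \<in> {z \<in> topspace (top_of_set S). f z \<in> C}"
    then have "{v. f z v \<noteq> 0} \<in> K \<and> f z \<in> realized_simplex {v. f z v \<noteq> 0}"
      using f in_realization_iff[OF K] by auto
    moreover have "{v. f z v \<noteq> 0} \<subseteq> F" using F(2) z by auto
    ultimately show "z \<in> (\<Union>\<tau>\<in>?T. S \<inter> f -` (C \<inter> realized_simplex \<tau>))"
      using z by (intro UN_I[of "{v. f z v \<noteq> 0}"]) auto
  qed auto
  moreover have "closedin (top_of_set S) (S \<inter> f -` (C \<inter> realized_simplex \<tau>))" if "\<tau> \<in> ?T" for \<tau>
    by (rule continuous_closedin_preimage)
      (use that C closedin_realization_simplex cont in \<open>auto intro: continuous_on_coordinatewise_then_product\<close>)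
  moreover have "finite ?T" using F(1) by simp
  ultimately show "closedin (top_of_set S) {z \<in> topspace (top_of_set S). f z \<in> C}"
    by (simp only:) (intro closedin_Union, auto)
qed (use f in auto)

text \<open>A compact interval of times around \<open>t0\<close> serves all simplices at once, by the tube lemma.\<close>

lemma openin_prod_realization:
  fixes U :: "(real \<times> ('v \<Rightarrow> real)) set"
  assumes sub: "U \<subseteq> {0..1} \<times> topspace (realization K)"
    and op: "\<And>\<sigma>. \<sigma> \<in> K \<Longrightarrow>
      openin (top_of_set ({0..1} \<times> realized_simplex \<sigma>)) (U \<inter> {0..1} \<times> realized_simplex \<sigma>)"
  shows "openin (prod_topology (top_of_set {0..1}) (realization K)) U"
proof (subst openin_subopen, intro ballI)
  fix p assume "p \<in> U"
  obtain t0 x0 where p: "p = (t0, x0)" by (cases p)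
  have t0: "t0 \<in> {0..1}" and "x0 \<in> topspace (realization K)" using \<open>p \<in> U\<close> sub p by auto
  then obtain \<sigma>0 where \<sigma>0: "\<sigma>0 \<in> K" "x0 \<in> realized_simplex \<sigma>0" unfolding topspace_realization by blast
  obtain O' where O': "open O'" "U \<inter> {0..1} \<times> realized_simplex \<sigma>0 = {0..1} \<times> realized_simplex \<sigma>0 \<inter> O'"
    using op[OF \<sigma>0(1)] unfolding openin_open by blast
  have "open {t. (t, x0) \<in> O'}"
    using open_vimage[OF O'(1), of "\<lambda>t. (t, x0)"] by (simp add: vimage_def continuous_on_Pair)
  moreover have "(t0, x0) \<in> O'" using O'(2) \<open>p \<in> U\<close> p t0 \<sigma>0 by blast
  ultimately obtain e where e: "e > 0" "cball t0 e \<subseteq> {t. (t, x0) \<in> O'}"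
    unfolding open_contains_cball by blast
  define J where "J = cball t0 e \<inter> {0..1}"
  define W where "W = {x \<in> topspace (realization K). \<forall>t\<in>J. (t, x) \<in> U}"
  have J: "compact J" "J \<subseteq> {0..1}" unfolding J_def by (auto intro: compact_Int_closed)
  have "openin (realization K) W"
    unfolding openin_realization
  proof (intro conjI ballI)
    show "W \<subseteq> (\<Union>\<sigma>\<in>K. realized_simplex \<sigma>)" unfolding W_def topspace_realization by blast
    fix \<sigma> assume \<sigma>: "\<sigma> \<in> K"
    let ?S = "realized_simplex \<sigma>"
    have "openin (top_of_set ({0..1} \<times> ?S)) ({0..1} \<times> ?S \<inter> U)"
      using op[OF \<sigma>] by (simp only: Int_commute)
    then have "openin (top_of_set (J \<times> ?S)) (J \<times> ?S \<inter> U)"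
      by (rule openin_subtopology_Int_subset) (use J(2) in auto)
    then have "closedin (top_of_set (J \<times> ?S)) (J \<times> ?S - J \<times> ?S \<inter> U)"
      by (intro closedin_diff) simp_all
    then have "closedin (prod_topology (top_of_set J) (top_of_set ?S)) (J \<times> ?S - U)"
      by (simp add: prod_topology_subtopology_eu Diff_Int)
    moreover have "closed_map (prod_topology (top_of_set J) (top_of_set ?S)) (top_of_set ?S) snd"
      by (rule closed_map_snd) (use J(1) in \<open>simp add: compact_space_subtopology\<close>)
    ultimately have "closedin (top_of_set ?S) (snd ` (J \<times> ?S - U))"
      unfolding closed_map_def by blast
    then have "openin (top_of_set ?S) (?S - snd ` (J \<times> ?S - U))"
      by (intro openin_diff) simp_all
    moreover have "?S - snd ` (J \<times> ?S - U) = W \<inter> ?S"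
    proof (intro subset_antisym subsetI)
      fix x assume x: "x \<in> ?S - snd ` (J \<times> ?S - U)"
      have "(t, x) \<in> U" if "t \<in> J" for t
      proof (rule ccontr)
        assume "(t, x) \<notin> U"
        then have "(t, x) \<in> J \<times> ?S - U" using that x by blast
        then have "x \<in> snd ` (J \<times> ?S - U)" by (metis image_eqI snd_conv)
        then show False using x by blast
      qed
      then show "x \<in> W \<inter> ?S" using x \<sigma> unfolding W_def topspace_realization by blast
    next
      fix x assume x: "x \<in> W \<inter> ?S"
      have "x \<noteq> snd q" if "q \<in> J \<times> ?S - U" for q
        using that x unfolding W_def by (cases q) auto
      then show "x \<in> ?S - snd ` (J \<times> ?S - U)" using x by blast
    qed
    ultimately show "openin (top_of_set ?S) (W \<inter> ?S)" by simp
  qed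
  moreover have "openin (top_of_set {0..1}) (ball t0 e \<inter> {0..1})"
    unfolding openin_open by (intro exI[of _ "ball t0 e"]) auto
  ultimately have "openin (prod_topology (top_of_set {0..1}) (realization K)) ((ball t0 e \<inter> {0..1}) \<times> W)"
    by (simp add: openin_prod_Times_iff)
  moreover have "p \<in> (ball t0 e \<inter> {0..1}) \<times> W"
  proof -
    have "(t, x0) \<in> U" if "t \<in> J" for t
    proof -
      have "(t, x0) \<in> {0..1} \<times> realized_simplex \<sigma>0 \<inter> O'" using that e(2) \<sigma>0(2) unfolding J_def by auto
      then show ?thesis using O'(2) by blast
    qed
    then show ?thesis unfolding p W_def using e(1) t0 \<open>x0 \<in> topspace _\<close> by auto
  qed
  moreover have "(ball t0 e \<inter> {0..1}) \<times> W \<subseteq> U"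
    unfolding W_def J_def using ball_subset_cball by blast
  ultimately show "\<exists>T. openin (prod_topology (top_of_set {0..1}) (realization K)) T \<and> p \<in> T \<and> T \<subseteq> U"
    by blast
qed

text \<open>The product with a compact interval still carries the weak topology of the products with
  single simplices; homotopies can thus be checked simplex by simplex.\<close>

lemma continuous_map_prod_realization:
  fixes g :: "real \<times> ('v \<Rightarrow> real) \<Rightarrow> 'b"
  assumes "\<And>\<sigma>. \<sigma> \<in> K \<Longrightarrow> continuous_map (top_of_set ({0..1} \<times> realized_simplex \<sigma>)) Y g"
  shows "continuous_map (prod_topology (top_of_set {0..1}) (realization K)) Y g"
  unfolding continuous_map_def
proof (intro conjI allI impI funcsetI)
  fix p assume "p \<in> topspace (prod_topology (top_of_set {0..1::real}) (realization K))"
  then obtain \<sigma> where \<sigma>: "\<sigma> \<in> K" "p \<in> {0..1} \<times> realized_simplex \<sigma>"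
    unfolding topspace_prod_topology topspace_realization by auto
  then show "g p \<in> topspace Y"
    using continuous_map_funspace[OF assms[OF \<sigma>(1)]] by (auto simp: Pi_iff)
next
  fix V assume V: "openin Y V"
  let ?U = "{p \<in> topspace (prod_topology (top_of_set {0..1::real}) (realization K)). g p \<in> V}"
  show "openin (prod_topology (top_of_set {0..1}) (realization K)) ?U"
  proof (rule openin_prod_realization)
    show "?U \<subseteq> {0..1} \<times> topspace (realization K)" by auto
    fix \<sigma> assume \<sigma>: "\<sigma> \<in> K"
    have "openin (top_of_set ({0..1} \<times> realized_simplex \<sigma>)) {p \<in> {0..1} \<times> realized_simplex \<sigma>. g p \<in> V}"
      using openin_continuous_map_preimage[OF assms[OF \<sigma>] V] by simp
    moreover have "?U \<inter> {0..1} \<times> realized_simplex \<sigma> = {p \<in> {0..1} \<times> realized_simplex \<sigma>. g p \<in> V}"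
      using \<sigma> unfolding topspace_prod_topology topspace_realization by auto
    ultimately show "openin (top_of_set ({0..1} \<times> realized_simplex \<sigma>)) (?U \<inter> {0..1} \<times> realized_simplex \<sigma>)"
      by simp
  qed
qed

section \<open>The equivariant contraction\<close>

text \<open>Discarding zero weights keeps the maximum over a finite set even when \<open>A\<close>
  is infinite; the value is 0 when \<open>A\<close> carries no weight.\<close>

definition weight_max :: "'v set \<Rightarrow> ('v \<Rightarrow> real) \<Rightarrow> real" where
  "weight_max A x = Max (insert 0 (x ` {w \<in> A. x w \<noteq> 0}))"

lemma weight_max_eq:
  assumes "{v. x v \<noteq> 0} \<subseteq> F"
  shows "weight_max A x = Max (insert 0 (x ` (F \<inter> A)))"
proof -
  have "insert 0 (x ` {w \<in> A. x w \<noteq> 0}) = insert 0 (x ` (F \<inter> A))" using assms by force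
  then show ?thesis unfolding weight_max_def by simp
qed

lemma weight_max_nonneg: "finite {v. x v \<noteq> 0} \<Longrightarrow> 0 \<le> weight_max A x"
  unfolding weight_max_def by (intro Max_ge) auto

lemma weight_max_ge:
  assumes "finite {v. x v \<noteq> 0}" "w \<in> A" shows "x w \<le> weight_max A x"
proof (cases "x w = 0")
  case True
  then show ?thesis using weight_max_nonneg[OF assms(1)] by simp
next
  case False
  then show ?thesis unfolding weight_max_def using assms by (intro Max_ge) auto
qed

lemma weight_max_attained:
  assumes "finite {v. x v \<noteq> 0}" "weight_max A x \<noteq> 0"
  obtains w where "w \<in> A" "x w = weight_max A x"
proof -
  have "weight_max A x \<in> insert 0 (x ` {w \<in> A. x w \<noteq> 0})"
    unfolding weight_max_def using assms(1) by (intro Max_in) auto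
  then show ?thesis using assms(2) that by auto
qed

lemma continuous_on_weight_max:
  assumes "finite F" "\<And>v. continuous_on S (\<lambda>z. f z v)"
    "\<And>z. z \<in> S \<Longrightarrow> {v. f z v \<noteq> 0} \<subseteq> F"
  shows "continuous_on S (\<lambda>z. weight_max A (f z))"
proof -
  have "continuous_on S (\<lambda>z. Max (insert (0::real) (f z ` B)))" if "finite B" for B
    using that
  proof (induction B)
    case (insert b B)
    have "Max (insert 0 (f z ` insert b B)) = max (f z b) (Max (insert 0 (f z ` B)))" for z
      using insert.hyps(1) by (subst image_insert, subst insert_commute, subst Max_insert) auto
    then show ?case using insert.IH assms(2) by (simp only:) (intro continuous_on_max)
  qed simp
  from this[of "F \<inter> A"] show ?thesis
    using assms(1,3) by (subst continuous_on_cong[OF refl weight_max_eq]) auto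
qed

text \<open>\<open>push\<close> gives full slice lengths to each receiving vertex and does not
  preserve the total weight; this restores the sum 1.\<close>

definition normalized :: "('v \<Rightarrow> real) \<Rightarrow> 'v \<Rightarrow> real" where
  "normalized u v = u v / (\<Sum>w | u w \<noteq> 0. u w)"

lemma normalized_realization:
  assumes K: "simplicial_complex K" and u: "\<And>v. 0 \<le> u v" "{v. u v \<noteq> 0} \<in> K"
  shows "normalized u \<in> topspace (realization K)" "normalized u v \<noteq> 0 \<longleftrightarrow> u v \<noteq> 0"
proof -
  have "finite {v. u v \<noteq> 0}" "{v. u v \<noteq> 0} \<noteq> {}" using K u(2) unfolding simplicial_complex_def by blast+
  moreover have "0 < u v" if "v \<in> {v. u v \<noteq> 0}" for v using that u(1)[of v] by simp
  ultimately have pos: "0 < (\<Sum>w | u w \<noteq> 0. u w)" by (rule sum_pos)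
  show eq: "normalized u v \<noteq> 0 \<longleftrightarrow> u v \<noteq> 0" for v unfolding normalized_def using pos by simp
  have "normalized u \<in> realized_simplex {v. u v \<noteq> 0}"
    unfolding realized_simplex_def normalized_def
    using u(1) pos by (auto simp: sum_divide_distrib[symmetric])
  then show "normalized u \<in> topspace (realization K)" unfolding topspace_realization using u(2) by blast
qed

lemma normalized_id:
  assumes "x \<in> realized_simplex {v. x v \<noteq> 0}" shows "normalized x = x"
  using assms unfolding realized_simplex_def normalized_def by auto

lemma realized_simplex_le_1:
  assumes "finite \<sigma>" "x \<in> realized_simplex \<sigma>" shows "x v \<le> 1"
proof (cases "v \<in> \<sigma>")
  case True
  then have "x v \<le> (\<Sum>v\<in>\<sigma>. x v)"
    using assms by (intro member_le_sum) (auto simp: realized_simplex_def)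
  then show ?thesis using assms unfolding realized_simplex_def by simp
qed (use assms in \<open>auto simp: realized_simplex_def\<close>)

locale based_complex = weakly_systolic_complex K for K :: "'v set set" +
  fixes \<sigma>\<^sub>0 :: "'v set"
  assumes base: "\<sigma>\<^sub>0 \<in> K"
begin

abbreviation L :: "nat \<Rightarrow> 'v set" where "L \<equiv> common_ball \<sigma>\<^sub>0"
abbreviation T :: "nat \<Rightarrow> 'v set" where "T n \<equiv> L (Suc n) - L n"
abbreviation P :: "nat \<Rightarrow> ('v \<Rightarrow> real) set" where
  "P n \<equiv> {x \<in> topspace (realization K). \<forall>v. x v \<noteq> 0 \<longrightarrow> v \<in> L n}"

lemma P_support:
  assumes "x \<in> P n"
  shows "{v. x v \<noteq> 0} \<in> K" "x \<in> realized_simplex {v. x v \<noteq> 0}" "finite {v. x v \<noteq> 0}"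
    "0 \<le> x v" "x v \<le> 1"
proof -
  show "{v. x v \<noteq> 0} \<in> K" and x: "x \<in> realized_simplex {v. x v \<noteq> 0}"
    using assms in_realization_iff[OF complex] by blast+
  then show fin: "finite {v. x v \<noteq> 0}" using simplex_finite by blast
  show "0 \<le> x v" using x unfolding realized_simplex_def by blast
  show "x v \<le> 1" using realized_simplex_le_1[OF fin x] .
qed

lemma P_mono: "m \<le> n \<Longrightarrow> P m \<subseteq> P n"
  using common_ball_mono by blast

text \<open>Write \<open>\<tau>\<^sub>\<lambda>\<close> for the set of vertices of the top layer with weight greater than \<open>\<lambda>\<close>. At time \<open>t\<close>
  the slices \<open>0 < \<lambda> < t\<close> of the top weights have been moved to the projections of the
  simplices \<open>\<tau>\<^sub>\<lambda>\<close>. A vertex \<open>v\<close> of the lower layer lies in the projection of \<open>\<tau>\<^sub>\<lambda>\<close> if and only if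
  \<open>\<lambda>\<close> is at least the largest weight of a top vertex not adjacent to \<open>v\<close>; the length of this
  range of \<open>\<lambda>\<close> is what \<open>v\<close> receives.\<close>

definition push :: "nat \<Rightarrow> real \<Rightarrow> ('v \<Rightarrow> real) \<Rightarrow> 'v \<Rightarrow> real" where
  "push n t x v =
     (if v \<in> T n then max (x v - t) 0
      else if v \<in> L n then x v +
        max 0 (min t (weight_max (T n) x) - weight_max {w \<in> T n. \<not> adj v w} x)
      else 0)"

lemma push_id:
  assumes x: "x \<in> P (Suc n)" and "t = 0 \<or> 0 \<le> t \<and> x \<in> P n"
  shows "push n t x = x"
proof
  fix v
  note fin = P_support(3)[OF x] and nn = P_support(4)[OF x]
  have "min t (weight_max (T n) x) \<le> 0"
  proof (cases "t = 0")
    case False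
    then have "x \<in> P n" using assms(2) by blast
    have "weight_max (T n) x = 0"
    proof (rule ccontr)
      assume *: "weight_max (T n) x \<noteq> 0"
      then obtain w where "w \<in> T n" "x w = weight_max (T n) x" using weight_max_attained[OF fin] by blast
      then show False using * \<open>x \<in> P n\<close> by auto
    qed
    then show ?thesis by simp
  qed simp
  moreover have "0 \<le> weight_max {w \<in> T n. \<not> adj v w} x" using weight_max_nonneg[OF fin] .
  moreover have "x v = 0" if "v \<notin> L (Suc n)" using x that by blast
  moreover have "max (x v - t) 0 = x v" if "v \<in> T n"
  proof (cases "t = 0")
    case False
    then have "x \<in> P n" "0 \<le> t" using assms(2) by blast+
    then have "x v = 0" using that by blast
    then show ?thesis using \<open>0 \<le> t\<close> by simp
  qed (use nn[of v] in simp)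
  ultimately show "push n t x v = x v"
    unfolding push_def using common_ball_mono[of n "Suc n"] by auto
qed

lemma push_nonneg: "x \<in> P (Suc n) \<Longrightarrow> 0 \<le> push n t x v"
  unfolding push_def using P_support(4)[of x "Suc n" v] by auto

text \<open>The superlevel simplices of the slices moved so far all contain \<open>A\<close>, so
  their projections lie in the projection \<open>D\<close> of \<open>A\<close>, and \<open>A\<close>
  together with \<open>D\<close> spans a simplex.\<close>

lemma push_simplex:
  assumes x: "x \<in> P (Suc n)" and n: "n \<ge> 1" and t: "0 \<le> t"
  shows "{v. push n t x v \<noteq> 0} \<in> K"
proof (cases "x \<in> P n")
  case True
  then show ?thesis using push_id[OF x] t P_support(1)[OF x] by simp
next
  case False
  note fin = P_support(3)[OF x] and nn = P_support(4)[OF x]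
  define M where "M = weight_max (T n) x"
  define \<tau> where "\<tau> = {w \<in> T n. x w \<noteq> 0}"
  obtain w0 where "x w0 \<noteq> 0" "w0 \<in> T n" using False x by blast
  then have "\<tau> \<noteq> {}" unfolding \<tau>_def by blast
  have "0 < x w0" using nn[of w0] \<open>x w0 \<noteq> 0\<close> by simp
  then have M: "0 < M" unfolding M_def using weight_max_ge[OF fin \<open>w0 \<in> T n\<close>] by linarith
  obtain w1 where w1: "w1 \<in> T n" "x w1 = M"
    using weight_max_attained[OF fin, of "T n"] M unfolding M_def by (metis less_irrefl)
  \<comment> \<open>Once \<open>t\<close> reaches the largest weight \<open>M\<close>, the
    superlevel set at \<open>t\<close> is empty; the vertices of weight exactly \<open>M\<close>
    form the last nonempty one and take its place.\<close>
  define A where "A = {w \<in> T n. if t < M then t < x w else x w = M}"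
  have w1A: "w1 \<in> A" unfolding A_def using w1 by simp
  have A\<tau>: "A \<subseteq> \<tau>" unfolding A_def \<tau>_def using t M by (auto split: if_splits)
  have "A \<subseteq> {v. x v \<noteq> 0}" using A\<tau> unfolding \<tau>_def by blast
  then have AK: "A \<in> K" using simplex_face[OF P_support(1)[OF x]] w1A by blast
  have \<tau>K: "\<tau> \<in> K" using simplex_face[OF P_support(1)[OF x], of \<tau>] \<open>\<tau> \<noteq> {}\<close> unfolding \<tau>_def by blast
  have proj: "{y \<in> L n. \<forall>a\<in>B. adj y a} \<in> K" if "B \<in> K" "B \<subseteq> T n" for B
    using common_ball_descent[OF base n that] .
  define D where "D = {y \<in> L n. \<forall>a\<in>A. adj y a}"
  have DK: "D \<in> K" unfolding D_def by (rule proj) (use AK in \<open>auto simp: A_def\<close>)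
  have "A \<union> D \<in> K"
  proof (rule clique_simplex)
    show "A \<union> D \<subseteq> V" using simplex_subset AK DK by blast
    show "A \<union> D \<noteq> {}" using w1A by blast
    fix u w assume "u \<in> A \<union> D" "w \<in> A \<union> D" "u \<noteq> w"
    moreover have "adj u w" if "u \<in> A" "w \<in> D" for u w using that adj_sym unfolding D_def by blast
    ultimately show "adj u w"
      using simplex_adj[OF AK] simplex_adj[OF DK] adj_sym by blast
  qed
  moreover have "{v. push n t x v \<noteq> 0} \<subseteq> A \<union> D"
  proof
    fix v assume v: "v \<in> {v. push n t x v \<noteq> 0}"
    show "v \<in> A \<union> D"
    proof (cases "v \<in> T n")
      case True
      then have "t < x v" using v unfolding push_def by (auto split: if_splits)
      moreover have "x v \<le> M" unfolding M_def using weight_max_ge[OF fin True] .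
      ultimately show ?thesis unfolding A_def using True by simp
    next
      case False
      then have vL: "v \<in> L n" using v unfolding push_def by (auto split: if_splits)
      have "adj v a" if a: "a \<in> A" for a
      proof (cases "x v = 0")
        case True
        have "weight_max {w \<in> T n. \<not> adj v w} x < min t M"
          using v vL False True unfolding push_def M_def by (auto split: if_splits)
        moreover have "min t M \<le> x a" using a unfolding A_def by (auto split: if_splits)
        ultimately show ?thesis
          using weight_max_ge[OF fin, of a "{w \<in> T n. \<not> adj v w}"] a unfolding A_def by fastforce
      next
        case False
        have "a \<noteq> v" using vL a unfolding A_def by blast
        moreover have "x a \<noteq> 0" using a A\<tau> unfolding \<tau>_def by blast
        ultimately show ?thesis using simplex_adj[OF P_support(1)[OF x]] False by blast
      qed
      then show ?thesis unfolding D_def using vL by blast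
    qed
  qed
  moreover have "{v. push n t x v \<noteq> 0} \<noteq> {}"
  proof (cases "t < M")
    case True
    then have "push n t x w1 \<noteq> 0" unfolding push_def using w1 by auto
    then show ?thesis by blast
  next
    case False
    \<comment> \<open>A vertex in the projection of the whole top simplex receives every slice, that
      is, the weight \<open>M\<close>, so the result is not zero.\<close>
    obtain y where y: "y \<in> L n" "\<forall>a\<in>\<tau>. adj y a"
      using simplex_nonempty[OF proj[OF \<tau>K]] unfolding \<tau>_def by blast
    have "weight_max {w \<in> T n. \<not> adj y w} x = 0"
    proof (rule ccontr)
      assume *: "\<not> ?thesis"
      then obtain w where "w \<in> T n" "\<not> adj y w" "x w = weight_max {w \<in> T n. \<not> adj y w} x"
        using weight_max_attained[OF fin] by blast
      then show False using * y(2) unfolding \<tau>_def by auto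
    qed
    then have "push n t x y \<noteq> 0"
      unfolding push_def using y(1) False M nn[of y] unfolding M_def by auto
    then show ?thesis by blast
  qed
  ultimately show ?thesis using simplex_face by blast
qed

definition slide :: "nat \<Rightarrow> real \<Rightarrow> ('v \<Rightarrow> real) \<Rightarrow> 'v \<Rightarrow> real" where
  "slide n t x = normalized (push n t x)"

lemma slide_id:
  assumes "x \<in> P (Suc n)" "t = 0 \<or> 0 \<le> t \<and> x \<in> P n"
  shows "slide n t x = x"
  unfolding slide_def push_id[OF assms] by (rule normalized_id) (rule P_support(2)[OF assms(1)])

lemma slide_support: "\<lbrakk>x \<in> P (Suc n); n \<ge> 1; 0 \<le> t\<rbrakk> \<Longrightarrow> slide n t x v \<noteq> 0 \<longleftrightarrow> push n t x v \<noteq> 0"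
  unfolding slide_def
  by (rule normalized_realization(2)[OF complex]) (auto intro: push_nonneg push_simplex)

lemma slide_realization: "\<lbrakk>x \<in> P (Suc n); n \<ge> 1; 0 \<le> t\<rbrakk> \<Longrightarrow> slide n t x \<in> topspace (realization K)"
  unfolding slide_def
  by (rule normalized_realization(1)[OF complex]) (auto intro: push_nonneg push_simplex)

lemma slide_in: "\<lbrakk>x \<in> P (Suc n); n \<ge> 1; 0 \<le> t\<rbrakk> \<Longrightarrow> slide n t x \<in> P (Suc n)"
  using slide_realization[of x n t] slide_support[of x n t] common_ball_mono[of n "Suc n" \<sigma>\<^sub>0]
  by (auto simp: push_def split: if_splits)

text \<open>Barycentric coordinates are at most 1, so time 1 empties the top layer.\<close>

lemma slide_1_in:
  assumes "x \<in> P (Suc n)" "n \<ge> 1" shows "slide n 1 x \<in> P n"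
proof -
  have "v \<in> L n" if "slide n 1 x v \<noteq> 0" for v
    using that slide_support[OF assms, of 1 v] P_support(5)[OF assms(1), of v]
    by (auto simp: push_def split: if_splits)
  then show ?thesis using slide_realization[OF assms] by simp
qed

text \<open>A substitute for continuity into the weak topology that is easy to propagate through
  explicit coordinate formulas; \<open>continuous_map_into_realization\<close> turns it into
  continuity at the end.\<close>

definition coordinatewise_family :: "'a::topological_space set \<Rightarrow> nat \<Rightarrow> ('a \<Rightarrow> 'v \<Rightarrow> real) \<Rightarrow> bool" where
  "coordinatewise_family S n f \<longleftrightarrow> (\<forall>v. continuous_on S (\<lambda>z. f z v)) \<and> (\<forall>z\<in>S. f z \<in> P n) \<and>
     (\<exists>F. finite F \<and> (\<forall>z\<in>S. {v. f z v \<noteq> 0} \<subseteq> F))"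

lemma coordinatewise_family_subset:
  "\<lbrakk>coordinatewise_family S n f; S' \<subseteq> S\<rbrakk> \<Longrightarrow> coordinatewise_family S' n f"
  unfolding coordinatewise_family_def by (meson continuous_on_subset subsetD)

lemma slide_coordinatewise_family:
  assumes f: "coordinatewise_family S (Suc n) f" and n: "n \<ge> 1"
    and t: "continuous_on S t" "\<And>z. z \<in> S \<Longrightarrow> 0 \<le> t z"
  shows "coordinatewise_family S (Suc n) (\<lambda>z. slide n (t z) (f z))"
proof -
  obtain F where F: "finite F" "\<And>z. z \<in> S \<Longrightarrow> {v. f z v \<noteq> 0} \<subseteq> F"
    using f unfolding coordinatewise_family_def by blast
  have fP: "f z \<in> P (Suc n)" if "z \<in> S" for z using f that unfolding coordinatewise_family_def by blast
  have cont: "continuous_on S (\<lambda>z. f z v)" for v using f unfolding coordinatewise_family_def by blast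
  \<comment> \<open>A vertex that newly receives weight is adjacent to a top vertex of largest
    weight. For a fixed top vertex the neighbors in \<open>L n\<close> form a simplex, so
    \<open>F'\<close> is finite even if vertices have infinitely many neighbors.\<close>
  define F' where "F' = F \<union> (\<Union>w\<in>F \<inter> T n. {y \<in> L n. adj y w})"
  have "finite {y \<in> L n. adj y w}" if "w \<in> T n" for w
  proof -
    have "{w} \<in> K" using that vertex_simplex unfolding common_ball_def by blast
    then have "{y \<in> L n. \<forall>a\<in>{w}. adj y a} \<in> K" using common_ball_descent[OF base n] that by blast
    then show ?thesis using simplex_finite by fastforce
  qed
  then have finF': "finite F'" unfolding F'_def using F(1) by blast
  have supp: "{v. push n (t z) (f z) v \<noteq> 0} \<subseteq> F'" if z: "z \<in> S" for z
  proof
    fix v assume v: "v \<in> {v. push n (t z) (f z) v \<noteq> 0}"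
    note fin = P_support(3)[OF fP[OF z]] and nn = P_support(4)[OF fP[OF z]]
    show "v \<in> F'"
    proof (cases "f z v = 0")
      case False
      then show ?thesis unfolding F'_def using F(2)[OF z] by blast
    next
      case True
      then have vL: "v \<in> L n" and
        lt: "weight_max {w \<in> T n. \<not> adj v w} (f z) < min (t z) (weight_max (T n) (f z))"
        using v t(2)[OF z] unfolding push_def by (auto split: if_splits)
      have pos: "0 < weight_max (T n) (f z)"
        using lt weight_max_nonneg[OF fin, of "{w \<in> T n. \<not> adj v w}"] by linarith
      then obtain w where w: "w \<in> T n" "f z w = weight_max (T n) (f z)"
        using weight_max_attained[OF fin, of "T n"] by (metis less_irrefl)
      have "adj v w"
        using weight_max_ge[OF fin, of w "{w \<in> T n. \<not> adj v w}"] w lt by fastforce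
      moreover have "w \<in> F" using F(2)[OF z] w pos by auto
      ultimately show ?thesis unfolding F'_def using w(1) vL by blast
    qed
  qed
  have cpush: "continuous_on S (\<lambda>z. push n (t z) (f z) v)" for v
  proof -
    have "continuous_on S (\<lambda>z. weight_max A (f z))" for A
      using continuous_on_weight_max[OF F(1) cont F(2)] by blast
    note c = continuous_on_max continuous_on_min continuous_on_add continuous_on_diff
      continuous_on_const cont t(1) this
    consider "v \<in> T n" | "v \<notin> T n" "v \<in> L n" | "v \<notin> T n" "v \<notin> L n" by blast
    then show ?thesis
    proof cases
      case 1
      then show ?thesis unfolding push_def by (simp only: if_True) (intro c)
    next
      case 2
      then show ?thesis unfolding push_def by (simp only: if_True if_False) (intro c)
    next
      case 3
      then show ?thesis unfolding push_def by (simp only: if_False) (intro c)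
    qed
  qed
  have sum_eq: "(\<Sum>w | push n (t z) (f z) w \<noteq> 0. push n (t z) (f z) w) = (\<Sum>w\<in>F'. push n (t z) (f z) w)"
    if "z \<in> S" for z
    using supp[OF that] finF' by (intro sum.mono_neutral_left) auto
  have sum_ne: "(\<Sum>w | push n (t z) (f z) w \<noteq> 0. push n (t z) (f z) w) \<noteq> 0" if "z \<in> S" for z
  proof -
    have s: "{v. push n (t z) (f z) v \<noteq> 0} \<in> K" using push_simplex[OF fP[OF that] n t(2)[OF that]] .
    have "0 < (\<Sum>w | push n (t z) (f z) w \<noteq> 0. push n (t z) (f z) w)"
      using simplex_finite[OF s] simplex_nonempty[OF s] push_nonneg[OF fP[OF that]]
      by (intro sum_pos) (auto simp: less_le)
    then show ?thesis by simp
  qed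
  have "continuous_on S (\<lambda>z. slide n (t z) (f z) v)" for v
  proof -
    have "continuous_on S (\<lambda>z. push n (t z) (f z) v / (\<Sum>w\<in>F'. push n (t z) (f z) w))"
      using sum_ne sum_eq cpush by (intro continuous_intros) auto
    then show ?thesis
      unfolding slide_def normalized_def using sum_eq by (subst continuous_on_cong[OF refl]) auto
  qed
  moreover have "slide n (t z) (f z) \<in> P (Suc n)" if "z \<in> S" for z
    using slide_in[OF fP[OF that] n t(2)[OF that]] .
  moreover have "{v. slide n (t z) (f z) v \<noteq> 0} \<subseteq> F'" if "z \<in> S" for z
    using supp[OF that] slide_support[OF fP[OF that] n t(2)[OF that]] by simp
  ultimately show ?thesis unfolding coordinatewise_family_def using finF' by blast
qed

section \<open>The flow through finitely many layers\<close>

lemma base_card: "0 < card \<sigma>\<^sub>0"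
  using simplex_finite[OF base] simplex_nonempty[OF base] by (simp add: card_gt_0_iff)

definition barycenter :: "'v \<Rightarrow> real" where
  "barycenter v = (if v \<in> \<sigma>\<^sub>0 then 1 / real (card \<sigma>\<^sub>0) else 0)"

lemma barycenter_simplex: "barycenter \<in> realized_simplex \<sigma>\<^sub>0"
  unfolding realized_simplex_def barycenter_def using base_card by auto

lemma base_L: "\<sigma>\<^sub>0 \<subseteq> L 1"
proof
  fix v assume v: "v \<in> \<sigma>\<^sub>0"
  have "d s v \<le> 1" if "s \<in> \<sigma>\<^sub>0" for s
    using simplex_adj[OF base that v] d_adj[of s v] by (cases "s = v") auto
  then show "v \<in> L 1" unfolding common_ball_def using v simplex_subset[OF base] by blast
qed

text \<open>For \<open>s \<in> [n, n + 1]\<close> the point \<open>x\<close> is first retracted to the layers up to \<open>n + 1\<close> and then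
  moved along \<open>slide n\<close> up to time \<open>n + 1 - s\<close>; below \<open>s = 1\<close> it moves on a segment to the barycenter
  of the base simplex.\<close>

primrec flow :: "nat \<Rightarrow> real \<Rightarrow> ('v \<Rightarrow> real) \<Rightarrow> 'v \<Rightarrow> real" where
  "flow 0 s x = (\<lambda>v. min s 1 * x v + (1 - min s 1) * barycenter v)"
| "flow (Suc n) s x =
    (if s \<le> real (Suc n) then flow n s (slide (Suc n) 1 x)
     else slide (Suc n) (max 0 (real n + 2 - s)) x)"

lemma flow_id: "\<lbrakk>x \<in> P (Suc n); real (Suc n) \<le> s\<rbrakk> \<Longrightarrow> flow n s x = x"
proof (cases n)
  case (Suc m)
  assume "x \<in> P (Suc n)" "real (Suc n) \<le> s"
  then show ?thesis using Suc slide_id[of x "Suc m" 0] by simp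
qed auto

text \<open>\<open>slide (Suc n)\<close> fixes the points of \<open>P (Suc n)\<close>. Hence the
  trajectory of a point does not depend on how far out the flow starts, and the flows for different
  \<open>n\<close> fit together.\<close>

lemma flow_Suc: "\<lbrakk>x \<in> P (Suc n)\<rbrakk> \<Longrightarrow> flow (Suc n) s x = flow n s x"
proof -
  assume x: "x \<in> P (Suc n)"
  have "x \<in> P (Suc (Suc n))" using x P_mono[of "Suc n" "Suc (Suc n)"] by auto
  then have "slide (Suc n) t x = x" if "0 \<le> t" for t
    using slide_id[of x "Suc n" t] x that by blast
  then show ?thesis using flow_id[OF x] by auto
qed

lemma flow_eq:
  assumes "x \<in> P (Suc m)" "m \<le> n" shows "flow n s x = flow m s x"
  using assms(2)
proof (induction n rule: dec_induct)
  case (step n)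
  have "x \<in> P (Suc n)" using assms(1) P_mono[of "Suc m" "Suc n"] step.hyps by auto
  then show ?case using step.IH flow_Suc by simp
qed simp

lemma flow_0_in:
  assumes x: "x \<in> P 1" and s: "0 \<le> s" shows "flow 0 s x \<in> P 1"
proof -
  let ?\<rho> = "{v. x v \<noteq> 0}"
  let ?u = "min s 1"
  have \<rho>: "?\<rho> \<in> K" "x \<in> realized_simplex ?\<rho>" using P_support[OF x] by blast+
  have "?\<rho> \<subseteq> L 1" using x by blast
  then have K: "?\<rho> \<union> \<sigma>\<^sub>0 \<in> K" using common_ball_1[OF base \<rho>(1)] by blast
  have u: "0 \<le> ?u" "?u \<le> 1" using s by auto
  have xb: "x \<in> realized_simplex (?\<rho> \<union> \<sigma>\<^sub>0)" "barycenter \<in> realized_simplex (?\<rho> \<union> \<sigma>\<^sub>0)"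
    using realized_simplex_mono[OF simplex_finite[OF K]] \<rho>(2) barycenter_simplex by blast+
  then have "(\<Sum>v\<in>?\<rho> \<union> \<sigma>\<^sub>0. flow 0 s x v) = ?u * 1 + (1 - ?u) * 1"
    unfolding realized_simplex_def by (simp add: sum.distrib sum_distrib_left[symmetric])
  moreover have "0 \<le> flow 0 s x v" for v
    using xb u unfolding realized_simplex_def by (simp add: add_nonneg_nonneg)
  moreover have z: "flow 0 s x v = 0" if "v \<notin> ?\<rho> \<union> \<sigma>\<^sub>0" for v
    using that by (simp add: barycenter_def)
  ultimately have "flow 0 s x \<in> realized_simplex (?\<rho> \<union> \<sigma>\<^sub>0)"
    unfolding realized_simplex_def by simp
  moreover have "v \<in> L 1" if "flow 0 s x v \<noteq> 0" for v
    using z that \<open>?\<rho> \<subseteq> L 1\<close> base_L by blast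
  ultimately show ?thesis unfolding topspace_realization using K by blast
qed

lemma flow_coordinatewise_family:
  assumes "coordinatewise_family S (Suc n) f" "continuous_on S s" "\<And>z. z \<in> S \<Longrightarrow> 0 \<le> s z"
  shows "coordinatewise_family S (Suc n) (\<lambda>z. flow n (s z) (f z))"
  using assms
proof (induction n arbitrary: S f)
  case 0
  then obtain F where F: "finite F" "\<And>z. z \<in> S \<Longrightarrow> {v. f z v \<noteq> 0} \<subseteq> F"
    and c: "\<And>v. continuous_on S (\<lambda>z. f z v)" and P: "\<And>z. z \<in> S \<Longrightarrow> f z \<in> P 1"
    unfolding coordinatewise_family_def by auto
  have "continuous_on S (\<lambda>z. flow 0 (s z) (f z) v)" for v
    using c 0(2) by (auto intro!: continuous_intros)
  moreover have "flow 0 (s z) (f z) \<in> P (Suc 0)" if "z \<in> S" for z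
    using flow_0_in[OF P[OF that] 0(3)[OF that]] by simp
  moreover have "{v. flow 0 (s z) (f z) v \<noteq> 0} \<subseteq> F \<union> \<sigma>\<^sub>0" if "z \<in> S" for z
    using F(2)[OF that] by (auto simp: barycenter_def split: if_splits)
  moreover have "finite (F \<union> \<sigma>\<^sub>0)" using F(1) simplex_finite[OF base] by simp
  ultimately show ?case unfolding coordinatewise_family_def by blast
next
  case (Suc n)
  note f = Suc.prems(1) and s = Suc.prems(2,3)
  let ?lo = "{z \<in> S. s z \<le> real (Suc n)}" and ?hi = "{z \<in> S. real (Suc n) \<le> s z}"
  let ?t = "\<lambda>z. max 0 (real n + 2 - s z)"
  have fP: "f z \<in> P (Suc (Suc n))" if "z \<in> S" for z
    using f that unfolding coordinatewise_family_def by blast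
  have "coordinatewise_family ?lo (Suc (Suc n)) (\<lambda>z. slide (Suc n) 1 (f z))"
    by (rule slide_coordinatewise_family[OF coordinatewise_family_subset[OF f]]) auto
  moreover have s1: "slide (Suc n) 1 (f z) \<in> P (Suc n)" if "z \<in> S" for z
    using slide_1_in[OF fP[OF that]] by simp
  ultimately have "coordinatewise_family ?lo (Suc n) (\<lambda>z. slide (Suc n) 1 (f z))"
    unfolding coordinatewise_family_def by blast
  then have lo: "coordinatewise_family ?lo (Suc n) (\<lambda>z. flow n (s z) (slide (Suc n) 1 (f z)))"
    by (rule Suc.IH) (use s in \<open>auto intro: continuous_on_subset\<close>)
  have hi: "coordinatewise_family ?hi (Suc (Suc n)) (\<lambda>z. slide (Suc n) (?t z) (f z))"
    by (rule slide_coordinatewise_family[OF coordinatewise_family_subset[OF f]])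
      (use s in \<open>auto intro!: continuous_intros intro: continuous_on_subset\<close>)
  have "continuous_on S (\<lambda>z. if s z \<le> real (Suc n) then flow n (s z) (slide (Suc n) 1 (f z)) v
      else slide (Suc n) (?t z) (f z) v)" for v
  proof (rule continuous_on_cases_le)
    show "continuous_on ?lo (\<lambda>z. flow n (s z) (slide (Suc n) 1 (f z)) v)"
      using lo unfolding coordinatewise_family_def by blast
    show "continuous_on ?hi (\<lambda>z. slide (Suc n) (?t z) (f z) v)"
      using hi unfolding coordinatewise_family_def by blast
    \<comment> \<open>At this moment \<open>?t z\<close> is exactly 1, and \<open>flow n\<close>
      rests from time \<open>Suc n\<close> on, so both branches equal
      \<open>slide (Suc n) 1 (f z)\<close>.\<close>
    fix z assume z: "z \<in> S" "s z = real (Suc n)"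
    then show "flow n (s z) (slide (Suc n) 1 (f z)) v = slide (Suc n) (?t z) (f z) v"
      using flow_id[OF s1[OF z(1)], of "s z"] by simp
  qed (rule s)
  then have "continuous_on S (\<lambda>z. flow (Suc n) (s z) (f z) v)" for v
    by (simp add: if_distrib[of "\<lambda>h. h v"] cong: if_cong)
  moreover have "flow (Suc n) (s z) (f z) \<in> P (Suc (Suc n))" if z: "z \<in> S" for z
  proof (cases "s z \<le> real (Suc n)")
    case True
    then have "flow n (s z) (slide (Suc n) 1 (f z)) \<in> P (Suc n)"
      using lo z unfolding coordinatewise_family_def by blast
    then show ?thesis using True P_mono[of "Suc n" "Suc (Suc n)"] by auto
  next
    case False
    then have "slide (Suc n) (?t z) (f z) \<in> P (Suc (Suc n))"
      using hi z unfolding coordinatewise_family_def by auto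
    then show ?thesis using False by simp
  qed
  moreover have "\<exists>F. finite F \<and> (\<forall>z\<in>S. {v. flow (Suc n) (s z) (f z) v \<noteq> 0} \<subseteq> F)"
  proof -
    obtain F1 F2 where F1: "finite F1" "\<forall>z\<in>?lo. {v. flow n (s z) (slide (Suc n) 1 (f z)) v \<noteq> 0} \<subseteq> F1"
      and F2: "finite F2" "\<forall>z\<in>?hi. {v. slide (Suc n) (?t z) (f z) v \<noteq> 0} \<subseteq> F2"
      using lo hi unfolding coordinatewise_family_def by blast
    have "{v. flow (Suc n) (s z) (f z) v \<noteq> 0} \<subseteq> F1 \<union> F2" if "z \<in> S" for z
      using F1(2) F2(2) that by (cases "s z \<le> real (Suc n)") auto
    then show ?thesis using F1(1) F2(1) by (intro exI[of _ "F1 \<union> F2"]) blast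
  qed
  ultimately show ?case unfolding coordinatewise_family_def by blast
qed

lemma flow_end: "x \<in> P (Suc n) \<Longrightarrow> flow n 0 x = barycenter"
proof (induction n arbitrary: x)
  case (Suc n)
  then show ?case using slide_1_in[of x "Suc n"] by simp
qed auto

section \<open>The flow of unbounded duration as a homotopy\<close>

definition level :: "('v \<Rightarrow> real) \<Rightarrow> nat" where
  "level x = (LEAST n. x \<in> P (Suc n))"

text \<open>The substitution \<open>s = 1 / t - 1\<close> compresses infinite flow time into the
  unit interval: \<open>t = 0\<close> stands for infinite time, at which no point has started to
  move, and \<open>t = 1\<close> for time 0, at which all have reached the barycenter.\<close>

definition contraction :: "real \<times> ('v \<Rightarrow> real) \<Rightarrow> 'v \<Rightarrow> real" where
  "contraction = (\<lambda>(t, x). if t = 0 then x else flow (level x) (1 / t - 1) x)"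

lemma simplex_level:
  assumes "\<sigma> \<in> K" obtains n where "realized_simplex \<sigma> \<subseteq> P (Suc n)"
proof -
  obtain n where n: "\<sigma> \<subseteq> L (Suc n)"
    using common_ball_exhausts[OF base simplex_finite[OF assms] simplex_subset[OF assms]] .
  have "x \<in> P (Suc n)" if "x \<in> realized_simplex \<sigma>" for x
    using that assms n realized_simplex_support(1)[OF simplex_finite[OF assms] that]
    unfolding topspace_realization by blast
  then show ?thesis by (intro that subsetI)
qed

lemma level_P:
  assumes "x \<in> topspace (realization K)" shows "x \<in> P (Suc (level x))"
proof -
  obtain \<sigma> where \<sigma>: "\<sigma> \<in> K" "x \<in> realized_simplex \<sigma>"
    using assms unfolding topspace_realization by blast
  obtain n where "realized_simplex \<sigma> \<subseteq> P (Suc n)" using simplex_level[OF \<sigma>(1)] .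
  then have "x \<in> P (Suc n)" using \<sigma>(2) by (rule subsetD)
  then show ?thesis unfolding level_def by (rule LeastI)
qed

lemma level_le: "x \<in> P (Suc n) \<Longrightarrow> level x \<le> n"
  unfolding level_def by (rule Least_le)

text \<open>On \<open>P (Suc n)\<close> the flow rests for times at least \<open>n + 1\<close>, that
  is, for \<open>t\<close> at most \<open>1 / (n + 2)\<close>. Cutting \<open>t\<close> off there
  removes the singularity at 0 and the dependence on \<open>level\<close>.\<close>

lemma contraction_eq:
  assumes x: "x \<in> P (Suc n)" and t: "t \<in> {0..1}"
  shows "contraction (t, x) = flow n (1 / max t (1 / (real n + 2)) - 1) x"
proof -
  let ?m = "level x"
  have m: "x \<in> P (Suc ?m)" "?m \<le> n" using level_P level_le[OF x] x by blast+
  show ?thesis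
  proof (cases "1 / (real n + 2) \<le> t")
    case True
    moreover have "0 < 1 / (real n + 2)" by simp
    ultimately have "t \<noteq> 0" "max t (1 / (real n + 2)) = t" by linarith+
    then show ?thesis unfolding contraction_def using flow_eq[OF m] by simp
  next
    case False
    then have "max t (1 / (real n + 2)) = 1 / (real n + 2)" by simp
    then have r: "flow n (1 / max t (1 / (real n + 2)) - 1) x = x" using flow_id[OF x] by simp
    have "flow ?m (1 / t - 1) x = x" if "t \<noteq> 0"
    proof (rule flow_id[OF m(1)])
      have "real n + 2 \<le> 1 / t" using False t that by (simp add: field_simps)
      then show "real (Suc ?m) \<le> 1 / t - 1" using m(2) by simp
    qed
    then show ?thesis using r unfolding contraction_def by simp
  qed
qed

lemma continuous_contraction:
  "continuous_map (prod_topology (top_of_set {0..1}) (realization K)) (realization K) contraction"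
proof (rule continuous_map_prod_realization)
  fix \<sigma> assume \<sigma>: "\<sigma> \<in> K"
  obtain n where sub: "realized_simplex \<sigma> \<subseteq> P (Suc n)" using simplex_level[OF \<sigma>] .
  have n: "x \<in> P (Suc n)" if "x \<in> realized_simplex \<sigma>" for x using sub that by (rule subsetD)
  let ?S = "{0..1} \<times> realized_simplex \<sigma>"
  let ?s = "\<lambda>z::real \<times> ('v \<Rightarrow> real). 1 / max (fst z) (1 / (real n + 2)) - 1"
  have pos: "0 < max (fst z) (1 / (real n + 2))" for z :: "real \<times> ('v \<Rightarrow> real)"
    by (simp add: less_max_iff_disj)
  have "coordinatewise_family ?S (Suc n) snd"
    unfolding coordinatewise_family_def
  proof (intro conjI allI ballI exI[of _ \<sigma>])
    show "continuous_on ?S (\<lambda>z. snd z v)" for v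
      by (rule continuous_on_product_then_coordinatewise) (intro continuous_intros)
    show "snd z \<in> P (Suc n)" if "z \<in> ?S" for z using n that by auto
    show "{v. snd z v \<noteq> 0} \<subseteq> \<sigma>" if "z \<in> ?S" for z
      using realized_simplex_support(1)[OF simplex_finite[OF \<sigma>], of "snd z"] that by auto
  qed (rule simplex_finite[OF \<sigma>])
  moreover have "continuous_on ?S ?s"
  proof -
    have "max (fst z) (1 / (real n + 2)) \<noteq> 0" for z :: "real \<times> ('v \<Rightarrow> real)" using pos[of z] by linarith
    then show ?thesis by (intro continuous_intros ballI)
  qed
  moreover have "0 \<le> ?s z" if "z \<in> ?S" for z
  proof -
    have "max (fst z) (1 / (real n + 2)) \<le> 1" using that by auto
    then show ?thesis using pos[of z] by simp
  qed
  ultimately have "coordinatewise_family ?S (Suc n) (\<lambda>z. flow n (?s z) (snd z))"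
    by (rule flow_coordinatewise_family)
  then obtain F where F: "finite F" "\<And>z. z \<in> ?S \<Longrightarrow> {v. flow n (?s z) (snd z) v \<noteq> 0} \<subseteq> F"
    and c: "\<And>v. continuous_on ?S (\<lambda>z. flow n (?s z) (snd z) v)"
    and P: "\<And>z. z \<in> ?S \<Longrightarrow> flow n (?s z) (snd z) \<in> P (Suc n)"
    unfolding coordinatewise_family_def by blast
  have "continuous_map (top_of_set ?S) (realization K) (\<lambda>z. flow n (?s z) (snd z))"
    by (rule continuous_map_into_realization[OF complex c F(1)]) (use F(2) P in blast)+
  then show "continuous_map (top_of_set ?S) (realization K) contraction"
  proof (rule continuous_map_eq)
    fix z :: "real \<times> ('v \<Rightarrow> real)" assume "z \<in> topspace (top_of_set ?S)"
    then show "flow n (?s z) (snd z) = contraction z"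
      using contraction_eq[OF n, of "snd z" "fst z"] by auto
  qed
qed

lemma contractible_invariant_subspace:
  assumes "X \<subseteq> topspace (realization K)" "\<And>t x. \<lbrakk>t \<in> {0..1}; x \<in> X\<rbrakk> \<Longrightarrow> contraction (t, x) \<in> X"
  shows "contractible_space (subtopology (realization K) X)"
proof -
  let ?X = "subtopology (realization K) X"
  have "continuous_map (prod_topology (top_of_set {0..1}) ?X) ?X contraction"
    unfolding continuous_map_in_subtopology
  proof
    show "continuous_map (prod_topology (top_of_set {0..1}) ?X) (realization K) contraction"
      unfolding prod_topology_subtopology(2)
      by (rule continuous_map_from_subtopology[OF continuous_contraction])
    show "contraction \<in> topspace (prod_topology (top_of_set {0..1}) ?X) \<rightarrow> X"
      using assms by auto
  qed
  moreover have "contraction (0, x) = x" for x unfolding contraction_def by simp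
  moreover have "contraction (1, x) = barycenter" if "x \<in> topspace ?X" for x
    unfolding contraction_def using flow_end level_P that by simp
  ultimately have "homotopic_with (\<lambda>x. True) ?X ?X id (\<lambda>x. barycenter)"
    by (subst homotopic_with) auto
  then show ?thesis unfolding contractible_space_def by blast
qed

end

section \<open>Equivariance of the contraction\<close>

locale invariant_base = invariant_family K \<G> + based_complex K \<sigma>\<^sub>0
  for K :: "'v set set" and \<G> :: "('v \<Rightarrow> 'v) set" and \<sigma>\<^sub>0 :: "'v set" +
  assumes base_invariant: "\<And>g. g \<in> \<G> \<Longrightarrow> g ` \<sigma>\<^sub>0 = \<sigma>\<^sub>0"
begin

definition invariant_point :: "('v \<Rightarrow> real) \<Rightarrow> bool" where
  "invariant_point x \<longleftrightarrow> (\<forall>g\<in>\<G>. \<forall>v\<in>V. x (g v) = x v)"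

lemma L_invariant: "\<lbrakk>g \<in> \<G>; v \<in> V\<rbrakk> \<Longrightarrow> g v \<in> L n \<longleftrightarrow> v \<in> L n"
proof -
  assume g: "g \<in> \<G>" and v: "v \<in> V"
  have "(\<forall>s\<in>\<sigma>\<^sub>0. d s (g v) \<le> n) \<longleftrightarrow> (\<forall>s\<in>g ` \<sigma>\<^sub>0. d s (g v) \<le> n)"
    using base_invariant[OF g] by simp
  also have "\<dots> \<longleftrightarrow> (\<forall>s\<in>\<sigma>\<^sub>0. d s v \<le> n)"
    using image_d[OF g _ v] simplex_subset[OF base] by (simp add: subset_iff)
  finally show ?thesis unfolding common_ball_def using v image_vertex[OF g v] by simp
qed

text \<open>The weights of the non-neighbors are the point to check: \<open>g\<close> and its
  inverse \<open>k\<close> carry the non-neighbors of \<open>v\<close> in the top layer to those of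
  \<open>g v\<close> and back, with equal weights, so both maxima agree.\<close>

lemma push_invariant:
  assumes x: "invariant_point x" shows "invariant_point (push n t x)"
  unfolding invariant_point_def
proof (intro ballI)
  fix g v assume g: "g \<in> \<G>" and v: "v \<in> V"
  have xg: "x (h w) = x w" if "h \<in> \<G>" "w \<in> V" for h w using x that unfolding invariant_point_def by blast
  have TV: "T n \<subseteq> V" unfolding common_ball_def by blast
  let ?A = "\<lambda>v. {w \<in> T n. \<not> adj v w}"
  obtain k where k: "k \<in> \<G>" "\<And>v. v \<in> V \<Longrightarrow> k (g v) = v \<and> g (k v) = v" using inv_family[OF g] by blast
  have "x ` {w \<in> ?A (g v). x w \<noteq> 0} = x ` {w \<in> ?A v. x w \<noteq> 0}"
  proof (intro subset_antisym subsetI)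
    fix y assume "y \<in> x ` {w \<in> ?A (g v). x w \<noteq> 0}"
    then obtain w where w: "w \<in> T n" "\<not> adj (g v) w" "x w \<noteq> 0" "y = x w" by blast
    have wV: "w \<in> V" using w(1) TV by blast
    have "k w \<in> T n" using w(1) L_invariant[OF k(1) wV] by blast
    moreover have "\<not> adj v (k w)" using image_adj[OF g, of v "k w"] w(2) k(2)[OF wV] by auto
    moreover have "x (k w) = x w" using xg[OF k(1) wV] .
    ultimately show "y \<in> x ` {w \<in> ?A v. x w \<noteq> 0}" using w(3,4) by (intro image_eqI[of _ _ "k w"]) auto
  next
    fix y assume "y \<in> x ` {w \<in> ?A v. x w \<noteq> 0}"
    then obtain w where w: "w \<in> T n" "\<not> adj v w" "x w \<noteq> 0" "y = x w" by blast
    have wV: "w \<in> V" using w(1) TV by blast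
    have "g w \<in> T n" using w(1) L_invariant[OF g wV] by blast
    moreover have "\<not> adj (g v) (g w)" using image_adj_iff[OF g v wV] w(2) by simp
    moreover have "x (g w) = x w" using xg[OF g wV] .
    ultimately show "y \<in> x ` {w \<in> ?A (g v). x w \<noteq> 0}" using w(3,4) by (intro image_eqI[of _ _ "g w"]) auto
  qed
  then have "weight_max (?A (g v)) x = weight_max (?A v) x" unfolding weight_max_def by simp
  then show "push n t x (g v) = push n t x v"
    unfolding push_def using L_invariant[OF g v] xg[OF g v] by simp
qed

lemma slide_invariant: "invariant_point x \<Longrightarrow> invariant_point (slide n t x)"
  using push_invariant[of x n t] unfolding invariant_point_def slide_def normalized_def by simp

lemma barycenter_invariant: "invariant_point barycenter"
  unfolding invariant_point_def
proof (intro ballI)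
  fix g v assume g: "g \<in> \<G>" and v: "v \<in> V"
  have "inj_on g V" using bij[OF g] unfolding bij_betw_def by blast
  then have "g v \<in> g ` \<sigma>\<^sub>0 \<longleftrightarrow> v \<in> \<sigma>\<^sub>0"
    using v simplex_subset[OF base] by (simp add: inj_on_image_mem_iff)
  then show "barycenter (g v) = barycenter v" unfolding barycenter_def base_invariant[OF g] by simp
qed

lemma flow_invariant: "invariant_point x \<Longrightarrow> invariant_point (flow n s x)"
proof (induction n arbitrary: x)
  case 0
  then show ?case using barycenter_invariant unfolding invariant_point_def by simp
qed (simp add: slide_invariant)

lemma contraction_invariant: "invariant_point x \<Longrightarrow> invariant_point (contraction (t, x))"
  unfolding contraction_def using flow_invariant by simp

lemma contractible_invariant_points:
  "contractible_space (subtopology (realization K) {x \<in> topspace (realization K). invariant_point x})"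
proof (rule contractible_invariant_subspace)
  fix t :: real and x assume t: "t \<in> {0..1}" and x: "x \<in> {x \<in> topspace (realization K). invariant_point x}"
  then have "contraction (t, x) \<in> topspace (realization K)"
    using continuous_map_funspace[OF continuous_contraction] by (auto simp: Pi_iff)
  then show "contraction (t, x) \<in> {x \<in> topspace (realization K). invariant_point x}"
    using contraction_invariant x by blast
qed blast

end

section \<open>Fixed point sets of finite subgroups\<close>

lemma fixed_points_finite_subgroup:
  assumes ws: "weakly_systolic K" and fd: "finite_dimensional K"
    and act: "simplicial_action G K \<phi>" and H: "subgroup H G" "finite H"
  shows "fixed_points G K \<phi> H \<noteq> {} \<and>
    contractible_space (subtopology (realization K) (fixed_points G K \<phi> H))"
proof -
  interpret weakly_systolic_complex K
    by unfold_locales (use ws in \<open>auto simp: weakly_systolic_def\<close>)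
  interpret group_action G "vertices K" \<phi> using act unfolding simplicial_action_def by blast
  have img: "\<And>g \<sigma>. \<lbrakk>g \<in> carrier G; \<sigma> \<in> K\<rbrakk> \<Longrightarrow> \<phi> g ` \<sigma> \<in> K"
    using act unfolding simplicial_action_def by blast
  have HG: "h \<in> carrier G" "inv\<^bsub>G\<^esub> h \<in> H" "inv\<^bsub>G\<^esub> h \<in> carrier G" if "h \<in> H" for h
    using H(1) that by (auto simp: subgroup.mem_carrier subgroup.m_inv_closed)
  have inv1: "\<phi> (inv\<^bsub>G\<^esub> h) (\<phi> h v) = v" if "h \<in> H" "v \<in> V" for h v
    using orbit_sym_aux[OF HG(1)[OF that(1)] that(2) refl] .
  have grp: "group G" using group_hom by (simp add: group_hom_def)
  have inv2: "\<phi> h (\<phi> (inv\<^bsub>G\<^esub> h) v) = v" if "h \<in> H" "v \<in> V" for h v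
    using inv1[OF HG(2)[OF that(1)] that(2)] group.inv_inv[OF grp HG(1)[OF that(1)]] by simp
  interpret invariant_family K "\<phi> ` H"
  proof
    show "finite (\<phi> ` H)" using H(2) by simp
    show "bij_betw g V V" if "g \<in> \<phi> ` H" for g
      using that bij_prop0 HG(1) by (auto simp: Bij_def)
    show "g ` \<sigma> \<in> K" if "g \<in> \<phi> ` H" "\<sigma> \<in> K" for g \<sigma>
      using that img HG(1) by auto
    show "\<exists>k\<in>\<phi> ` H. \<forall>v\<in>V. k v = g (h v)" if "g \<in> \<phi> ` H" "h \<in> \<phi> ` H" for g h
    proof -
      from that obtain a b where ab: "a \<in> H" "b \<in> H" "g = \<phi> a" "h = \<phi> b" by blast
      then have "\<phi> (a \<otimes>\<^bsub>G\<^esub> b) \<in> \<phi> ` H" using subgroup.m_closed[OF H(1)] by blast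
      then show ?thesis using composition_rule ab HG(1) by (intro bexI[of _ "\<phi> (a \<otimes>\<^bsub>G\<^esub> b)"]) auto
    qed
    show "\<exists>k\<in>\<phi> ` H. \<forall>v\<in>V. k (g v) = v \<and> g (k v) = v" if "g \<in> \<phi> ` H" for g
    proof -
      from that obtain a where a: "a \<in> H" "g = \<phi> a" by blast
      then show ?thesis using inv1 inv2 HG(2) by (intro bexI[of _ "\<phi> (inv\<^bsub>G\<^esub> a)"]) auto
    qed
    show "\<exists>k\<in>\<phi> ` H. \<forall>v\<in>V. k v = v"
    proof (intro bexI[of _ "\<phi> \<one>\<^bsub>G\<^esub>"] ballI)
      show "\<phi> \<one>\<^bsub>G\<^esub> v = v" if "v \<in> V" for v
        using id_eq_one that by (metis restrict_apply')
      show "\<phi> \<one>\<^bsub>G\<^esub> \<in> \<phi> ` H" using subgroup.one_closed[OF H(1)] by blast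
    qed
  qed
  obtain \<sigma>\<^sub>0 where \<sigma>\<^sub>0: "\<sigma>\<^sub>0 \<in> K" "\<And>g. g \<in> \<phi> ` H \<Longrightarrow> g ` \<sigma>\<^sub>0 = \<sigma>\<^sub>0"
    using invariant_simplex[OF fd] by blast
  interpret invariant_base K "\<phi> ` H" \<sigma>\<^sub>0
    by unfold_locales (use \<sigma>\<^sub>0 in auto)
  \<comment> \<open>\<open>realization_action\<close> substitutes the inverse of the group element;
    as \<open>H\<close> is closed under inverses, being fixed amounts to invariance of the
    coordinates under the maps in the image of \<open>H\<close>. Outside the vertex set both sides
    are 0.\<close>
  have "fixed_points G K \<phi> H = {x \<in> topspace (realization K). invariant_point x}"
    unfolding fixed_points_def
  proof (intro Collect_cong conj_cong refl iffI)
    fix x assume "x \<in> topspace (realization K)"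
      and fixed: "\<forall>h\<in>H. realization_action G K \<phi> h x = x"
    show "invariant_point x"
      unfolding invariant_point_def
    proof (intro ballI)
      fix g v assume "g \<in> \<phi> ` H" and v: "v \<in> V"
      then obtain h where h: "h \<in> H" "g = \<phi> h" by blast
      have gv: "g v \<in> V" using image_vertex \<open>g \<in> \<phi> ` H\<close> v by blast
      have "x (g v) = realization_action G K \<phi> h x (g v)" using fixed h(1) by simp
      also have "\<dots> = x v" unfolding realization_action_def using gv inv1[OF h(1) v] h(2) by simp
      finally show "x (g v) = x v" .
    qed
  next
    fix x assume x: "x \<in> topspace (realization K)" and "invariant_point x"
    have "realization_action G K \<phi> h x w = x w" if "h \<in> H" for h w
    proof (cases "w \<in> V")
      case True
      then show ?thesis
        using \<open>invariant_point x\<close> HG(2)[OF that]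
        unfolding realization_action_def invariant_point_def by simp
    next
      case False
      have "{v. x v \<noteq> 0} \<subseteq> V" using x in_realization_iff[OF complex] simplex_subset by blast
      then show ?thesis using False unfolding realization_action_def by auto
    qed
    then show "\<forall>h\<in>H. realization_action G K \<phi> h x = x" by blast
  qed
  moreover have "barycenter \<in> topspace (realization K)"
    using barycenter_simplex base unfolding topspace_realization by blast
  ultimately show ?thesis using contractible_invariant_points barycenter_invariant by auto
qed

theorem theoremE:
  fixes G :: "('g, 'b) monoid_scheme"
    and K :: "'v set set"
    and \<phi> :: "'g \<Rightarrow> 'v \<Rightarrow> 'v"
  assumes "weakly_systolic K"
    and "finite_dimensional K"
    and "simplicial_action G K \<phi>"
    and "proper_action G K \<phi>"
  shows "(finite_dimensional K \<and> model_EG G K \<phi>) \<and>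
         (cocompact_action G K \<phi> \<longrightarrow> finite_model_EG G K \<phi>)"
proof -
  have "model_EG G K \<phi>"
    unfolding model_EG_def
    using assms fixed_points_finite_subgroup[OF assms(1-3)] by (auto simp: weakly_systolic_def)
  then show ?thesis using assms(2) unfolding finite_model_EG_def by blast
qed

end
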